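(* Suppose $G$ is a finite nonabelian group that is minimally faithful of degree $2$. Then either $G\cong Q_8$ or $$G\cong \langle a,b \mid a^p=b^{2^m}=bab^{-1}a=1\rangle = C_p\rtimes C_{2^m}$$ for some odd prime $p$ and some $m\geq 1$.
   Context: For a finite group $G$, $\operatorname{rdim}(G)$ denotes the smallest dimension of a faithful complex linear representation of $G$. A finite group $G$ is called minimally faithful of degree $n$ if $\operatorname{rdim}(G)=n$ and $\operatorname{rdim}(H)<n$ for every proper subgroup $H$ of $G$. $C_n$ is the cyclic group of order $n$, and $Q_8$ is the quaternion group of order $8$. *)

theory Defs
  imports
    "HOL-Algebra.Algebra"
    "HOL-Computational_Algebra.Primes"
    "Jordan_Normal_Form.Matrix"
begin

section \<open>Faithful representations\<close>

definition GL :: "nat \<Rightarrow> complex mat monoid" where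
  "GL n = units_of (ring_mat TYPE(complex) n ())"

definition faithful_rep :: "('a, 'b) monoid_scheme \<Rightarrow> nat \<Rightarrow> ('a \<Rightarrow> complex mat) \<Rightarrow> bool" where
  "faithful_rep G n \<rho> \<longleftrightarrow> \<rho> \<in> hom G (GL n) \<and> inj_on \<rho> (carrier G)"

text \<open>The dimension \<open>n = 0\<close> is allowed (\<open>GL 0\<close> is trivial), so the trivial group has \<open>rdim\<close> 0.
  For a finite group the least dimension is attained, because the regular representation is
  faithful; for other arguments the value is meaningless.\<close>

definition rdim :: "('a, 'b) monoid_scheme \<Rightarrow> nat" where
  "rdim G = (LEAST n. \<exists>\<rho>. faithful_rep G n \<rho>)"

definition minimally_faithful :: "('a, 'b) monoid_scheme \<Rightarrow> nat \<Rightarrow> bool" where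
  "minimally_faithful G n \<longleftrightarrow>
     rdim G = n \<and>
     (\<forall>H. subgroup H G \<and> H \<noteq> carrier G \<longrightarrow> rdim (G\<lparr>carrier := H\<rparr>) < n)"

section \<open>The quaternion group of order 8\<close>

text \<open>The quadruple \<open>(a, b, c, d)\<close> stands for the integral quaternion \<open>a + b i + c j + d k\<close>.\<close>

type_synonym int_quat = "int \<times> int \<times> int \<times> int"

fun quat_mult :: "int_quat \<Rightarrow> int_quat \<Rightarrow> int_quat" where
  "quat_mult (a, b, c, d) (a', b', c', d') =
     (a * a' - b * b' - c * c' - d * d',
      a * b' + b * a' + c * d' - d * c',
      a * c' - b * d' + c * a' + d * b',
      a * d' + b * c' - c * b' + d * a')"

definition Q8 :: "int_quat monoid" where
  "Q8 = \<lparr>carrier = {(1, 0, 0, 0), (-1, 0, 0, 0), (0, 1, 0, 0), (0, -1, 0, 0),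
                    (0, 0, 1, 0), (0, 0, -1, 0), (0, 0, 0, 1), (0, 0, 0, -1)},
         monoid.mult = quat_mult, one = (1, 0, 0, 0)\<rparr>"

lemma quat_mult_assoc: "quat_mult (quat_mult x y) z = quat_mult x (quat_mult y z)"
  by (cases x; cases y; cases z) (simp add: algebra_simps)

lemma group_Q8: "group Q8"
proof (rule groupI)
  show "x \<otimes>\<^bsub>Q8\<^esub> y \<otimes>\<^bsub>Q8\<^esub> z = x \<otimes>\<^bsub>Q8\<^esub> (y \<otimes>\<^bsub>Q8\<^esub> z)" for x y z
    by (simp add: Q8_def quat_mult_assoc)
qed (auto simp: Q8_def)

lemma order_Q8: "order Q8 = 8"
  by (simp add: order_def Q8_def)

section \<open>Group presentations\<close>

text \<open>The free group has the elements of the whole type \<open>'x\<close> as its generators. A word is a list of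
  letters; the letter \<open>(True, x)\<close> stands for \<open>x\<close> and \<open>(False, x)\<close> for its formal inverse. Elements
  of the free group are classes of words modulo insertion and deletion of cancelling pairs.\<close>

type_synonym 'x word = "(bool \<times> 'x) list"

inductive cancels :: "'x word \<Rightarrow> 'x word \<Rightarrow> bool" where
  "cancels (u @ [(s, x), (\<not> s, x)] @ v) (u @ v)"

definition free_rel :: "('x word \<times> 'x word) set" where
  "free_rel = {(u, v). equivclp cancels u v}"

definition free_group :: "'x word set monoid" where
  "free_group =
     \<lparr>carrier = UNIV // free_rel,
      monoid.mult = (\<lambda>U V. \<Union>u\<in>U. \<Union>v\<in>V. free_rel `` {u @ v}),
      one = free_rel `` {[]}\<rparr>"

definition free_gen :: "'x \<Rightarrow> 'x word set" where
  "free_gen x = free_rel `` {[(True, x)]}"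

definition normal_closure :: "('a, 'b) monoid_scheme \<Rightarrow> 'a set \<Rightarrow> 'a set" where
  "normal_closure G R = \<Inter>{N. N \<lhd> G \<and> R \<subseteq> N}"

text \<open>The relators \<open>R\<close> are elements of the free group.\<close>

definition presented_group :: "'x word set set \<Rightarrow> 'x word set set monoid" where
  "presented_group R = free_group Mod normal_closure free_group R"

lemma equiv_free_rel: "equiv UNIV free_rel"
  by (rule equivI)
    (auto simp: free_rel_def refl_on_def sym_def trans_def
      intro: equivclp_sym equivclp_trans)

lemma cancels_append: "cancels u v \<Longrightarrow> cancels (w @ u @ z) (w @ v @ z)"
proof (induction rule: cancels.induct)
  case (1 u s x v)
  show ?case using cancels.intros[of "w @ u" s x "v @ z"] by simp
qed

lemma equivclp_cancels_append:
  "equivclp cancels u v \<Longrightarrow> equivclp cancels (w @ u @ z) (w @ v @ z)"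
proof (induction rule: equivclp_induct)
  case (step y y')
  then show ?case by (meson cancels_append equivclp_into_equivclp)
qed simp

lemma free_rel_append:
  assumes "(u, u') \<in> free_rel" "(v, v') \<in> free_rel"
  shows "(u @ v, u' @ v') \<in> free_rel"
  using equivclp_cancels_append[of u u' "[]" v] equivclp_cancels_append[of v v' u' "[]"] assms
  by (auto simp: free_rel_def intro: equivclp_trans)

lemma free_mult_class:
  "free_rel `` {u} \<otimes>\<^bsub>free_group\<^esub> free_rel `` {v} = free_rel `` {u @ v}"
proof -
  have "congruent2 free_rel free_rel (\<lambda>u v. free_rel `` {u @ v})"
    by (intro congruent2I') (simp add: free_rel_append equiv_class_eq[OF equiv_free_rel])
  then show ?thesis
    using UN_equiv_class2[OF equiv_free_rel equiv_free_rel _ UNIV_I UNIV_I]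
    by (simp add: free_group_def)
qed

lemma free_group_carrierE:
  assumes "U \<in> carrier free_group"
  obtains u where "U = free_rel `` {u}"
  using assms by (auto simp: free_group_def elim: quotientE)

lemma free_class_carrier [simp]: "free_rel `` {u} \<in> carrier free_group"
  by (simp add: free_group_def quotientI)

lemma free_one: "\<one>\<^bsub>free_group\<^esub> = free_rel `` {[]}"
  by (simp add: free_group_def)

lemma free_inverse: "(rev (map (map_prod Not id) u) @ u, []) \<in> free_rel"
proof (induction u)
  case Nil
  then show ?case by (simp add: free_rel_def)
next
  case (Cons l u)
  obtain s x where l: "l = (s, x)" by force
  have "cancels (rev (map (map_prod Not id) u) @ [(\<not> s, x), (\<not> \<not> s, x)] @ u)
          (rev (map (map_prod Not id) u) @ u)"
    by (rule cancels.intros)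
  then have "equivclp cancels (rev (map (map_prod Not id) (l # u)) @ l # u)
          (rev (map (map_prod Not id) u) @ u)"
    by (simp add: l r_into_equivclp)
  with Cons show ?case unfolding free_rel_def mem_Collect_eq case_prod_conv
    by (blast intro: equivclp_trans)
qed

lemma group_free_group: "group free_group"
proof (rule groupI)
  fix U assume "U \<in> carrier (free_group :: 'x word set monoid)"
  then obtain u where U: "U = free_rel `` {u}" by (rule free_group_carrierE)
  let ?V = "free_rel `` {rev (map (map_prod Not id) u)}"
  have "?V \<otimes>\<^bsub>free_group\<^esub> U = \<one>\<^bsub>free_group\<^esub>"
    unfolding U free_mult_class free_one
    by (rule equiv_class_eq[OF equiv_free_rel free_inverse])
  then show "\<exists>V\<in>carrier free_group. V \<otimes>\<^bsub>free_group\<^esub> U = \<one>\<^bsub>free_group\<^esub>"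
    by (rule bexI) simp
qed (auto elim!: free_group_carrierE simp: free_mult_class free_one)

lemma (in group) normal_closure_normal:
  assumes "R \<subseteq> carrier G"
  shows "normal_closure G R \<lhd> G"
proof -
  have "carrier G \<lhd> G"
    by (simp add: normal_inv_iff subgroup_self)
  then have ne: "{N. N \<lhd> G \<and> R \<subseteq> N} \<noteq> {}" using assms by blast
  have "subgroup (normal_closure G R) G"
    unfolding normal_closure_def using ne
    by (intro subgroups_Inter) (auto simp: normal_def)
  moreover have "x \<otimes> h \<otimes> inv x \<in> normal_closure G R"
    if "x \<in> carrier G" "h \<in> normal_closure G R" for x h
    using that by (auto simp: normal_closure_def intro: normal.inv_op_closed2)
  ultimately show ?thesis by (simp add: normal_inv_iff)
qed

lemma group_presented_group:
  "R \<subseteq> carrier free_group \<Longrightarrow> group (presented_group R)"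
  unfolding presented_group_def
  by (intro normal.factorgroup_is_group group.normal_closure_normal group_free_group)

datatype gen_ab = gen_a | gen_b

definition presented_G :: "nat \<Rightarrow> nat \<Rightarrow> gen_ab word set set monoid" where
  "presented_G p m =
     (let F = free_group; a = free_gen gen_a; b = free_gen gen_b in
      presented_group
        {a [^]\<^bsub>F\<^esub> p, b [^]\<^bsub>F\<^esub> ((2::nat) ^ m), b \<otimes>\<^bsub>F\<^esub> a \<otimes>\<^bsub>F\<^esub> inv\<^bsub>F\<^esub> b \<otimes>\<^bsub>F\<^esub> a})"

section \<open>Semidirect products\<close>

definition semidirect_product ::
  "('a, 'c) monoid_scheme \<Rightarrow> ('b \<Rightarrow> 'a \<Rightarrow> 'a) \<Rightarrow> ('b, 'd) monoid_scheme \<Rightarrow> ('a \<times> 'b) monoid" where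
  "semidirect_product N \<phi> H =
     \<lparr>carrier = carrier N \<times> carrier H,
      monoid.mult = (\<lambda>(n, h) (n', h'). (n \<otimes>\<^bsub>N\<^esub> \<phi> h n', h \<otimes>\<^bsub>H\<^esub> h')),
      one = (\<one>\<^bsub>N\<^esub>, \<one>\<^bsub>H\<^esub>)\<rparr>"

text \<open>The generator \<open>1\<close> of \<open>C_(2^m)\<close> acts on \<open>C_p\<close> by inversion, as the relator
  \<open>b a b\<^sup>-\<^sup>1 a\<close> prescribes. For \<open>m \<ge> 1\<close> parity is well defined modulo \<open>2^m\<close>; for \<open>m = 0\<close> the
  group acting is trivial.\<close>

definition inversion_action :: "nat \<Rightarrow> int \<Rightarrow> int \<Rightarrow> int" where
  "inversion_action p j x = (if even j then x else inv\<^bsub>integer_mod_group p\<^esub> x)"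

definition semidirect_G :: "nat \<Rightarrow> nat \<Rightarrow> (int \<times> int) monoid" where
  "semidirect_G p m =
     semidirect_product (integer_mod_group p) (inversion_action p) (integer_mod_group (2 ^ m))"

end

theory Submission
  imports Defs "HOL-Number_Theory.Cong"
begin

text \<open>
  A proper subgroup of \<open>G\<close> has a faithful representation of dimension at most 1, so it embeds in
  the multiplicative group of the complex numbers and is cyclic
  (\<open>rdim_less_two_imp_cyclic\<close>). Hence \<open>G\<close> is a finite nonabelian group all of whose proper
  subgroups are cyclic, and it has a faithful representation of dimension 2. The least dimension is
  attained because the regular representation is faithful (\<open>faithful_rep_exists\<close>).

  The centralizers of noncentral elements partition the noncentral part of \<open>G\<close>. If none of them were
  normal, each would be its own normalizer; the conjugates of one of them would then cover at least
  half of \<open>G\<close> but not all noncentral elements, and a second, disjoint family of conjugates would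
  leave no room for the identity. So some centralizer \<open>M\<close> of a noncentral element is normal
  (\<open>normal_centralizer_exists\<close>); it is cyclic, say \<open>M = \<langle>c\<rangle>\<close>.

  The representation forces \<open>M\<close> to have index 2. A matrix \<open>A\<close> of finite order and a conjugate
  \<open>X A X\<^sup>-\<^sup>1\<close> that commutes with \<open>A\<close> are simultaneously diagonalizable, so in dimension 2 the conjugate
  has the same two eigenvalues in the same or in the opposite order, and \<open>X\<^sup>2\<close> commutes with \<open>A\<close>
  (\<open>faithful_dim2_square_commutes\<close>). Thus all squares lie in \<open>M\<close>, and \<open>G = M \<union> b M\<close> for some \<open>b\<close>
  outside \<open>M\<close>, which can be chosen of 2-power order (\<open>cyclic_index_two_exists\<close>).

  The commutator \<open>d = b c b\<^sup>-\<^sup>1 c\<^sup>-\<^sup>1\<close> is inverted by \<open>b\<close>. If an odd prime \<open>p\<close> divides the order of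
  \<open>d\<close>, a power \<open>a\<close> of \<open>d\<close> has order \<open>p\<close> and is inverted by \<open>b\<close>; the subgroup \<open>\<langle>a, b\<rangle>\<close> is
  nonabelian, hence it is \<open>G\<close>, and \<open>G\<close> has the asserted presentation. Otherwise \<open>G\<close> is a 2-group.
  The proper subgroup \<open>\<langle>c\<^sup>2, b\<rangle>\<close> is abelian, so \<open>d\<^sup>2 = 1\<close>; there are no involutions outside \<open>M\<close>,
  because such an involution and \<open>d\<close> would generate a noncyclic proper subgroup of order 4. This
  leaves only \<open>|M| = 4\<close> and the quaternion group.
\<close>

section \<open>Conjugation, centralizers and finite subgroups\<close>

lemma nat_two_power_times_odd:
  assumes "(n::nat) > 0"
  obtains k r where "n = 2 ^ k * r" "odd r"
  using assms
proof (induction n arbitrary: thesis rule: less_induct)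
  case (less n)
  show ?case
  proof (cases "even n")
    case True
    then obtain n' where n': "n = 2 * n'" by blast
    then have "n' < n" "n' > 0" using less by auto
    then obtain k r where "n' = 2 ^ k * r" "odd r" using less.IH[of n'] by blast
    then show ?thesis using less.prems(1)[of "Suc k" r] n' by simp
  next
    case False
    then show ?thesis using less.prems(1)[of 0 n] by simp
  qed
qed

lemma (in group) pow_two_times:
  assumes "x \<in> carrier G"
  shows "x [^] (2 * i) = (x \<otimes> x) [^] (i::nat)"
proof -
  have "x [^] (2::nat) = x \<otimes> x" using assms by (simp add: numeral_2_eq_2)
  then show ?thesis using nat_pow_pow[OF assms, of 2 i] by simp
qed

context group
begin

definition conj_by :: "'a \<Rightarrow> 'a \<Rightarrow> 'a" where
  "conj_by h x = h \<otimes> x \<otimes> inv h"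

definition centralizer :: "'a \<Rightarrow> 'a set" where
  "centralizer g = {x \<in> carrier G. x \<otimes> g = g \<otimes> x}"

definition center :: "'a set" where
  "center = {x \<in> carrier G. \<forall>y \<in> carrier G. x \<otimes> y = y \<otimes> x}"

lemma conj_by_closed [simp]: "h \<in> carrier G \<Longrightarrow> x \<in> carrier G \<Longrightarrow> conj_by h x \<in> carrier G"
  by (simp add: conj_by_def)

lemma conj_by_one [simp]: "h \<in> carrier G \<Longrightarrow> conj_by h \<one> = \<one>"
  by (simp add: conj_by_def)

lemma conj_by_one_left [simp]: "x \<in> carrier G \<Longrightarrow> conj_by \<one> x = x"
  by (simp add: conj_by_def)

lemma conj_by_mult:
  assumes "h \<in> carrier G" "x \<in> carrier G" "y \<in> carrier G"
  shows "conj_by h (x \<otimes> y) = conj_by h x \<otimes> conj_by h y"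
proof -
  have "conj_by h x \<otimes> conj_by h y = h \<otimes> (x \<otimes> ((inv h \<otimes> h) \<otimes> (y \<otimes> inv h)))"
    using assms by (simp only: conj_by_def m_assoc inv_closed m_closed)
  then show ?thesis using assms by (simp add: conj_by_def m_assoc)
qed

lemma conj_by_conj_by:
  "g \<in> carrier G \<Longrightarrow> h \<in> carrier G \<Longrightarrow> x \<in> carrier G \<Longrightarrow> conj_by g (conj_by h x) = conj_by (g \<otimes> h) x"
  by (simp add: conj_by_def inv_mult_group m_assoc)

lemma conj_by_inv:
  assumes "h \<in> carrier G" "x \<in> carrier G"
  shows "conj_by h (inv x) = inv (conj_by h x)"
  using assms by (simp add: conj_by_def inv_mult_group m_assoc)

lemma conj_by_pow:
  "h \<in> carrier G \<Longrightarrow> x \<in> carrier G \<Longrightarrow> conj_by h (x [^] (n::nat)) = conj_by h x [^] n"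
  by (induction n) (simp_all add: conj_by_mult)

lemma conj_by_inv_left [simp]:
  "h \<in> carrier G \<Longrightarrow> x \<in> carrier G \<Longrightarrow> conj_by (inv h) (conj_by h x) = x"
  "h \<in> carrier G \<Longrightarrow> x \<in> carrier G \<Longrightarrow> conj_by h (conj_by (inv h) x) = x"
  by (simp_all add: conj_by_conj_by)

lemma conj_by_inject:
  "h \<in> carrier G \<Longrightarrow> x \<in> carrier G \<Longrightarrow> y \<in> carrier G \<Longrightarrow> conj_by h x = conj_by h y \<longleftrightarrow> x = y"
  by (metis conj_by_inv_left(1))

lemma conj_by_eq_iff:
  "h \<in> carrier G \<Longrightarrow> x \<in> carrier G \<Longrightarrow> y \<in> carrier G \<Longrightarrow> conj_by h x = y \<longleftrightarrow> h \<otimes> x = y \<otimes> h"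
  unfolding conj_by_def by (metis inv_solve_right' m_closed)

lemma finite_subgroupI:
  assumes "finite (carrier G)" "H \<subseteq> carrier G" "\<one> \<in> H"
    and "\<And>x y. x \<in> H \<Longrightarrow> y \<in> H \<Longrightarrow> x \<otimes> y \<in> H"
  shows "subgroup H G"
proof (rule subgroupI)
  fix x assume x: "x \<in> H"
  then have xG: "x \<in> carrier G" using assms by auto
  have pow: "x [^] (n::nat) \<in> H" for n
    by (induction n) (use assms x in auto)
  have "x [^] (ord x - 1) \<otimes> x = \<one>"
    using ord_ge_1[OF assms(1) xG] pow_ord_eq_1[OF xG]
    by (metis Suc_diff_le diff_Suc_1 nat_pow_Suc)
  then have "inv x = x [^] (ord x - 1)" using xG by (intro inv_equality) auto
  then show "inv x \<in> H" using pow by simp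
qed (use assms in auto)

lemma pow_mod_ord: "x \<in> carrier G \<Longrightarrow> x [^] (n mod ord x) = x [^] n"
proof -
  assume x: "x \<in> carrier G"
  have "x [^] n = x [^] (ord x * (n div ord x) + n mod ord x)" by simp
  also have "\<dots> = (x [^] ord x) [^] (n div ord x) \<otimes> x [^] (n mod ord x)"
    using x by (simp only: nat_pow_mult nat_pow_pow)
  finally show ?thesis using x by simp
qed

text \<open>The exponents of both involutions are odd multiples of half the order of \<open>t\<close>, so they differ by
  a multiple of the order.\<close>

lemma cyclic_unique_involution:
  assumes t: "t \<in> carrier G" and "x = t [^] (i::nat)" "y = t [^] (k::nat)"
    and "x \<otimes> x = \<one>" "y \<otimes> y = \<one>" "x \<noteq> \<one>" "y \<noteq> \<one>"
  shows "x = y"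
proof -
  let ?N = "int (ord t)"
  have "int (ord t) dvd 2 * int i" "int (ord t) dvd 2 * int k"
    using assms by (auto simp: nat_pow_mult pow_eq_id mult_2 simp flip: of_nat_add)
  then obtain u v where uv: "2 * int i = ?N * u" "2 * int k = ?N * v" by (auto elim!: dvdE)
  have "odd u"
  proof
    assume "even u"
    then obtain u' where "u = 2 * u'" by blast
    then have "?N dvd int i" using uv by simp
    then show False using assms by (simp add: pow_eq_id)
  qed
  moreover have "odd v"
  proof
    assume "even v"
    then obtain v' where "v = 2 * v'" by blast
    then have "?N dvd int k" using uv by simp
    then show False using assms by (simp add: pow_eq_id)
  qed
  ultimately have "even (v - u)" by simp
  then obtain s where s: "v - u = 2 * s" by blast
  have "2 * (int k - int i) = ?N * (v - u)" using uv by (simp add: algebra_simps)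
  then have "int k - int i = ?N * s" using s by simp
  then have "t [^] int i = t [^] int k" using t by (simp add: int_pow_eq)
  then show ?thesis using assms by (simp add: int_pow_int)
qed

lemma subgroup_centralizer:
  assumes "finite (carrier G)" "g \<in> carrier G"
  shows "subgroup (centralizer g) G"
proof (rule finite_subgroupI)
  fix x y assume "x \<in> centralizer g" "y \<in> centralizer g"
  then show "x \<otimes> y \<in> centralizer g"
    using assms(2) unfolding centralizer_def mem_Collect_eq by (metis m_assoc m_closed)
next
  show "finite (carrier G)" by fact
  show "centralizer g \<subseteq> carrier G" unfolding centralizer_def by blast
  show "\<one> \<in> centralizer g" using assms(2) by (simp add: centralizer_def)
qed

lemma subgroup_center:
  assumes "finite (carrier G)"
  shows "subgroup center G"
proof (rule finite_subgroupI)
  fix x y assume x: "x \<in> center" and y: "y \<in> center"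
  have G: "x \<in> carrier G" "y \<in> carrier G" using x y by (auto simp: center_def)
  have "x \<otimes> y \<otimes> u = u \<otimes> (x \<otimes> y)" if u: "u \<in> carrier G" for u
  proof -
    have "x \<otimes> y \<otimes> u = x \<otimes> (u \<otimes> y)" using y u G by (simp add: center_def m_assoc)
    also have "\<dots> = (u \<otimes> x) \<otimes> y" using x u G by (simp add: center_def flip: m_assoc)
    finally show ?thesis using u G by (simp add: m_assoc)
  qed
  then show "x \<otimes> y \<in> center" using G by (simp add: center_def)
qed (use assms in \<open>auto simp: center_def\<close>)

text \<open>Here \<open>b\<close> normalizes \<open>S\<close>, and \<open>b\<^sup>2 \<in> S\<close> gives \<open>b\<^sup>-\<^sup>1 \<in> b S\<close>. The classification repeatedly compares such
  subgroups with the whole group.\<close>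

lemma subgroup_Un_coset:
  assumes S: "subgroup S G" and b: "b \<in> carrier G" and bb: "b \<otimes> b \<in> S"
    and conj: "\<And>s. s \<in> S \<Longrightarrow> conj_by b s \<in> S"
  shows "subgroup (S \<union> (\<otimes>) b ` S) G"
proof (rule subgroupI)
  interpret S: subgroup S G by fact
  have SG: "s \<in> carrier G" if "s \<in> S" for s using that by simp
  have conj': "conj_by (inv b) s \<in> S" if "s \<in> S" for s
  proof -
    have "conj_by (inv b) s = conj_by (inv (b \<otimes> b)) (conj_by b s)"
      using b SG[OF that] by (simp add: conj_by_conj_by inv_mult_group m_assoc)
    also have "\<dots> \<in> S"
      unfolding conj_by_def using conj[OF that] bb b by (simp add: conj_by_def)
    finally show ?thesis .
  qed
  have swap: "s \<otimes> b = b \<otimes> conj_by (inv b) s" if "s \<in> S" for s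
    using b SG[OF that] by (simp add: conj_by_def m_assoc) (simp add: m_assoc[symmetric])
  show "S \<union> (\<otimes>) b ` S \<subseteq> carrier G" using b by auto
  show "S \<union> (\<otimes>) b ` S \<noteq> {}" using S.one_closed by blast
  fix x assume x: "x \<in> S \<union> (\<otimes>) b ` S"
  show "inv x \<in> S \<union> (\<otimes>) b ` S"
  proof (cases "x \<in> S")
    case False
    then obtain s where s: "s \<in> S" "x = b \<otimes> s" using x by blast
    have "inv x = inv s \<otimes> b \<otimes> inv (b \<otimes> b)"
      using s b SG[OF s(1)] by (simp add: inv_mult_group m_assoc) (simp add: m_assoc[symmetric])
    also have "\<dots> = b \<otimes> (conj_by (inv b) (inv s) \<otimes> inv (b \<otimes> b))"
      using s b SG[OF s(1)] by (simp add: swap m_assoc)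
    also have "\<dots> \<in> (\<otimes>) b ` S"
      by (rule imageI[OF S.m_closed[OF conj'[OF S.m_inv_closed[OF s(1)]] S.m_inv_closed[OF bb]]])
    finally show ?thesis by blast
  qed simp
  fix y assume y: "y \<in> S \<union> (\<otimes>) b ` S"
  have xs: "x \<otimes> y \<in> S \<union> (\<otimes>) b ` S" if "y \<in> S" for y
  proof (cases "x \<in> S")
    case False
    then obtain s where s: "s \<in> S" "x = b \<otimes> s" using x by blast
    then have "x \<otimes> y = b \<otimes> (s \<otimes> y)" using b that SG by (simp add: m_assoc)
    then show ?thesis using s that by blast
  qed (use that in simp)
  show "x \<otimes> y \<in> S \<union> (\<otimes>) b ` S"
  proof (cases "y \<in> S")
    case False
    then obtain t where t: "t \<in> S" "y = b \<otimes> t" using y by blast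
    show ?thesis
    proof (cases "x \<in> S")
      case True
      then have "x \<otimes> y = b \<otimes> (conj_by (inv b) x \<otimes> t)"
        using t b SG by (simp add: m_assoc[symmetric] swap)
      then show ?thesis using conj'[OF True] t by blast
    next
      case False
      then obtain s where s: "s \<in> S" "x = b \<otimes> s" using x by blast
      have "x \<otimes> y = b \<otimes> (s \<otimes> b) \<otimes> t" using s t b SG by (simp add: m_assoc)
      also have "\<dots> = (b \<otimes> b) \<otimes> (conj_by (inv b) s \<otimes> t)"
        using s t b SG by (simp add: swap) (simp add: m_assoc)
      also have "\<dots> \<in> S" by (rule S.m_closed[OF bb S.m_closed[OF conj'[OF s(1)] t(1)]])
      finally show ?thesis by blast
    qed
  qed (use xs in simp)
qed

end

section \<open>Representations of dimension at most one\<close>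

lemma GL_mult: "x \<otimes>\<^bsub>GL n\<^esub> y = x * y"
  by (simp add: GL_def units_of_def ring_mat_def)

lemma GL_carrierD: "A \<in> carrier (GL n) \<Longrightarrow> A \<in> carrier_mat n n"
  by (auto simp: GL_def units_of_def ring_mat_def Units_def)

lemma GL_one: "\<one>\<^bsub>GL n\<^esub> = 1\<^sub>m n"
  by (simp add: GL_def units_of_def ring_mat_def)

lemma group_GL: "group (GL n)"
proof -
  have "ring (ring_mat TYPE(complex) n ())" by (rule ring_mat)
  then have "monoid (ring_mat TYPE(complex) n ())" by (rule ring.is_monoid)
  then show ?thesis unfolding GL_def by (rule monoid.units_group)
qed

lemma (in group) hom_GLI:
  assumes \<rho>: "\<And>x. x \<in> carrier G \<Longrightarrow> \<rho> x \<in> carrier_mat n n"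
    and mult: "\<And>x y. x \<in> carrier G \<Longrightarrow> y \<in> carrier G \<Longrightarrow> \<rho> (x \<otimes> y) = \<rho> x * \<rho> y"
    and one: "\<rho> \<one> = 1\<^sub>m n"
  shows "\<rho> \<in> hom G (GL n)"
proof (rule homI)
  fix x assume x: "x \<in> carrier G"
  have "\<rho> (inv x) * \<rho> x = 1\<^sub>m n" "\<rho> x * \<rho> (inv x) = 1\<^sub>m n"
    using x one by (simp_all flip: mult)
  then show "\<rho> x \<in> carrier (GL n)"
    using x \<rho> by (auto simp: GL_def units_of_def ring_mat_def Units_def)
qed (simp add: mult GL_mult)

text \<open>The regular representation: \<open>g\<close> acts by the permutation matrix of left multiplication, and a
  single column already determines \<open>g\<close>.\<close>

lemma (in group) faithful_rep_exists:
  assumes "finite (carrier G)"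
  shows "\<exists>n \<rho>. faithful_rep G n \<rho>"
proof -
  define n where "n = card (carrier G)"
  obtain e where e: "bij_betw e {0..<n} (carrier G)"
    using ex_bij_betw_nat_finite[OF assms] unfolding n_def by blast
  have eG: "e i \<in> carrier G" if "i < n" for i using e that by (auto dest: bij_betwE)
  have e_eq: "e i = e j \<longleftrightarrow> i = j" if "i < n" "j < n" for i j
    using e that by (auto simp: bij_betw_def inj_on_def)
  define \<rho> :: "'a \<Rightarrow> complex mat"
    where "\<rho> g = mat n n (\<lambda>(i, j). if e i = g \<otimes> e j then 1 else 0)" for g
  have "\<rho> (g \<otimes> h) = \<rho> g * \<rho> h" if g: "g \<in> carrier G" and h: "h \<in> carrier G" for g h
  proof (rule eq_matI)
    fix i j assume ij: "i < dim_row (\<rho> g * \<rho> h)" "j < dim_col (\<rho> g * \<rho> h)"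
    then have i: "i < n" and j: "j < n" by (simp_all add: \<rho>_def)
    have "h \<otimes> e j \<in> e ` {0..<n}" using e eG[OF j] h by (simp add: bij_betw_def)
    then obtain k where k: "k < n" "e k = h \<otimes> e j" by auto
    have "(\<rho> g * \<rho> h) $$ (i, j) = (\<Sum>l\<in>{0..<n}. \<rho> g $$ (i, l) * \<rho> h $$ (l, j))"
      using i j by (simp add: \<rho>_def scalar_prod_def)
    also have "\<dots> = (\<Sum>l\<in>{0..<n}. if l = k then \<rho> g $$ (i, k) else 0)"
    proof (rule sum.cong)
      fix l assume "l \<in> {0..<n}"
      then have "e l = h \<otimes> e j \<longleftrightarrow> l = k" using e_eq[of l k] k by simp
      then show "\<rho> g $$ (i, l) * \<rho> h $$ (l, j) = (if l = k then \<rho> g $$ (i, k) else 0)"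
        using \<open>l \<in> {0..<n}\<close> j by (simp add: \<rho>_def)
    qed simp
    also have "\<dots> = \<rho> g $$ (i, k)" using k by simp
    also have "\<dots> = \<rho> (g \<otimes> h) $$ (i, j)"
      using i j k g h eG[OF j] by (simp add: \<rho>_def m_assoc)
    finally show "\<rho> (g \<otimes> h) $$ (i, j) = (\<rho> g * \<rho> h) $$ (i, j)" by simp
  qed (simp_all add: \<rho>_def)
  moreover have "\<rho> \<one> = 1\<^sub>m n"
    by (rule eq_matI) (auto simp: \<rho>_def eG e_eq)
  moreover have "inj_on \<rho> (carrier G)"
  proof (rule inj_onI)
    fix g h assume g: "g \<in> carrier G" and h: "h \<in> carrier G" and eq: "\<rho> g = \<rho> h"
    have n: "0 < n" using assms g by (auto simp: n_def card_gt_0_iff)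
    have "g \<otimes> e 0 \<in> e ` {0..<n}" using e eG[OF n] g by (simp add: bij_betw_def)
    then obtain k where k: "k < n" "e k = g \<otimes> e 0" by auto
    have "\<rho> g $$ (k, 0) = \<rho> h $$ (k, 0)" using eq by simp
    then have "e k = h \<otimes> e 0" using k n by (simp add: \<rho>_def split: if_splits)
    then show "g = h" using k g h eG[OF n] by simp
  qed
  moreover have "\<rho> g \<in> carrier_mat n n" for g by (simp add: \<rho>_def)
  ultimately have "faithful_rep G n \<rho>"
    unfolding faithful_rep_def by (intro conjI hom_GLI)
  then show ?thesis by blast
qed

lemma (in group) faithful_rep_rdim:
  assumes "finite (carrier G)"
  obtains \<rho> where "faithful_rep G (rdim G) \<rho>"
  using LeastI_ex[OF faithful_rep_exists[OF assms]] unfolding rdim_def by blast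

text \<open>The image consists of \<open>n\<close>-th roots of unity for the group order \<open>n\<close>, and there are just \<open>n\<close>
  of them, so a primitive root is attained; its preimage generates the group.\<close>

lemma (in group) injective_character_imp_cyclic:
  fixes \<chi> :: "'a \<Rightarrow> complex"
  assumes fin: "finite (carrier G)"
    and mult: "\<And>x y. x \<in> carrier G \<Longrightarrow> y \<in> carrier G \<Longrightarrow> \<chi> (x \<otimes> y) = \<chi> x * \<chi> y"
    and one: "\<chi> \<one> = 1" and inj: "inj_on \<chi> (carrier G)"
  shows "\<exists>c\<in>carrier G. \<forall>x\<in>carrier G. \<exists>i::nat. x = c [^] i"
proof -
  let ?n = "card (carrier G)"
  let ?r = "\<lambda>k. cis (2 * pi * real k / real ?n)"
  have n: "?n > 0" using fin by (auto simp: card_gt_0_iff)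
  have pow: "\<chi> (x [^] k) = \<chi> x ^ k" if "x \<in> carrier G" for x and k :: nat
    using that by (induction k) (simp_all add: one mult)
  have "\<chi> ` carrier G \<subseteq> {z. z ^ ?n = 1}"
    using pow_order_eq_1 by (auto simp: one order_def simp flip: pow)
  moreover have "card (\<chi> ` carrier G) = card {z :: complex. z ^ ?n = 1}"
    by (simp add: card_image[OF inj] card_roots_unity_eq[OF n])
  ultimately have "\<chi> ` carrier G = {z. z ^ ?n = 1}"
    by (intro card_subset_eq finite_roots_unity) (use n in auto)
  then have img: "\<chi> ` carrier G = ?r ` {..<?n}"
    using bij_betw_roots_unity[OF n] by (simp add: bij_betw_def)
  have gen: "?r k = cis (2 * pi / ?n) ^ k" for k
    by (simp add: DeMoivre mult_ac)
  have "cis (2 * pi / ?n) \<in> \<chi> ` carrier G"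
  proof (cases "?n = 1")
    case True
    then show ?thesis using one by (intro image_eqI[of _ _ \<one>]) (auto simp: complex_eq_iff)
  next
    case False
    then have "?r 1 \<in> ?r ` {..<?n}" using n by (intro imageI) simp
    then show ?thesis using img by simp
  qed
  then obtain c where c: "c \<in> carrier G" "\<chi> c = cis (2 * pi / ?n)" by force
  have "\<exists>i::nat. x = c [^] i" if x: "x \<in> carrier G" for x
  proof -
    have "\<chi> x \<in> ?r ` {..<?n}" using img x by blast
    then obtain k :: nat where "\<chi> x = \<chi> (c [^] k)"
      unfolding gen c(2)[symmetric] pow[OF c(1), symmetric] by blast
    then show ?thesis using inj x c(1) by (auto dest: inj_onD)
  qed
  with c show ?thesis by blast
qed

lemma (in group) rdim_less_two_imp_cyclic:
  assumes fin: "finite (carrier G)" and "rdim G < 2"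
  shows "\<exists>c\<in>carrier G. \<forall>x\<in>carrier G. \<exists>i::nat. x = c [^] i"
proof -
  let ?n = "rdim G"
  obtain \<rho> where \<rho>: "\<rho> \<in> hom G (GL ?n)" and inj: "inj_on \<rho> (carrier G)"
    using faithful_rep_rdim[OF fin] unfolding faithful_rep_def by blast
  have dim: "\<rho> x \<in> carrier_mat ?n ?n" if "x \<in> carrier G" for x
    using that \<rho> by (auto simp: hom_def intro: GL_carrierD)
  show ?thesis
  proof (cases "?n = 0")
    case True
    have "x = \<one>" if "x \<in> carrier G" for x
    proof (rule inj_onD[OF inj])
      show "\<rho> x = \<rho> \<one>" using dim[OF that] dim[of \<one>] True by (intro eq_matI) auto
    qed (use that in auto)
    then show ?thesis using nat_pow_one by (metis one_closed)
  next
    case False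
    then have n: "?n = 1" using assms by simp
    show ?thesis
    proof (rule injective_character_imp_cyclic[OF fin, of "\<lambda>x. \<rho> x $$ (0, 0)"])
      fix x y assume "x \<in> carrier G" "y \<in> carrier G"
      then show "\<rho> (x \<otimes> y) $$ (0, 0) = \<rho> x $$ (0, 0) * \<rho> y $$ (0, 0)"
        using dim[of x] dim[of y] n hom_mult[OF \<rho>] by (simp add: GL_mult scalar_prod_def)
    next
      show "\<rho> \<one> $$ (0, 0) = 1"
        using hom_one[OF \<rho> is_group group_GL] n by (simp add: GL_one)
    next
      show "inj_on (\<lambda>x. \<rho> x $$ (0, 0)) (carrier G)"
      proof (rule inj_onI)
        fix x y assume x: "x \<in> carrier G" and y: "y \<in> carrier G" and "\<rho> x $$ (0, 0) = \<rho> y $$ (0, 0)"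
        then have "\<rho> x = \<rho> y" using dim[OF x] dim[OF y] n by (intro eq_matI) auto
        then show "x = y" using inj x y by (auto dest: inj_onD)
      qed
    qed
  qed
qed

section \<open>Commuting conjugates in dimension two\<close>

definition trace2 :: "complex mat \<Rightarrow> complex" where
  "trace2 A = A $$ (0, 0) + A $$ (1, 1)"

definition det2 :: "complex mat \<Rightarrow> complex" where
  "det2 A = A $$ (0, 0) * A $$ (1, 1) - A $$ (0, 1) * A $$ (1, 0)"

text \<open>Matrices of size 2 are handled through their four entries, which turns matrix equations into
  polynomial identities.\<close>

lemma mult_mat2_index:
  assumes "A \<in> carrier_mat 2 2" "B \<in> carrier_mat 2 2" "i < 2" "j < 2"
  shows "(A * B) $$ (i, j) = A $$ (i, 0) * B $$ (0, j) + A $$ (i, 1) * B $$ (1, j)"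
  using assms by (simp add: scalar_prod_def numeral_2_eq_2)

lemma eq_mat2I:
  assumes "A \<in> carrier_mat 2 2" "B \<in> carrier_mat 2 2"
    and "A $$ (0, 0) = B $$ (0, 0)" "A $$ (0, 1) = B $$ (0, 1)"
    and "A $$ (1, 0) = B $$ (1, 0)" "A $$ (1, 1) = B $$ (1, 1)"
  shows "A = B"
proof (rule eq_matI)
  fix i j assume "i < dim_row B" "j < dim_col B"
  then have "i = 0 \<or> i = 1" "j = 0 \<or> j = 1" using assms by auto
  then show "A $$ (i, j) = B $$ (i, j)" using assms by auto
qed (use assms in auto)

lemma trace2_mult_commute:
  assumes "A \<in> carrier_mat 2 2" "B \<in> carrier_mat 2 2"
  shows "trace2 (A * B) = trace2 (B * A)"
  using assms by (simp add: trace2_def mult_mat2_index algebra_simps del: index_mult_mat)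

lemma cayley_hamilton2:
  assumes "A \<in> carrier_mat 2 2"
  shows "A * A = trace2 A \<cdot>\<^sub>m A - det2 A \<cdot>\<^sub>m 1\<^sub>m 2"
  using assms
  by (intro eq_mat2I)
    (auto simp: trace2_def det2_def mult_mat2_index algebra_simps simp del: index_mult_mat(1))

text \<open>Put \<open>N = D - A\<close>. As \<open>A\<close> and \<open>D\<close> have the same trace \<open>t\<close> and the same determinant and commute,
  Cayley--Hamilton gives \<open>N (D + A - t) = D\<^sup>2 - A\<^sup>2 - t (D - A) = 0\<close>. As \<open>N\<close> has trace 0, \<open>N\<^sup>2\<close> is a
  scalar. Either this scalar is 0, or \<open>N\<close> is invertible and \<open>D = t - A\<close>; in the second case
  conjugating once more gives \<open>t - D = A\<close>. The first alternative avoids any appeal to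
  diagonalization.\<close>

lemma mat2_commuting_conjugate:
  fixes A :: "complex mat"
  assumes A: "A \<in> carrier_mat 2 2" and P: "P \<in> carrier_mat 2 2" and Q: "Q \<in> carrier_mat 2 2"
    and PQ: "P * Q = 1\<^sub>m 2" and QP: "Q * P = 1\<^sub>m 2"
    and D: "D = P * A * Q" and comm: "A * D = D * A"
  shows "(D - A) * (D - A) = 0\<^sub>m 2 2 \<or> P * D * Q = A"
proof -
  have Dc: "D \<in> carrier_mat 2 2" using A P Q D by simp
  let ?t = "trace2 A"
  have tr: "trace2 D = ?t"
  proof -
    have "trace2 D = trace2 (Q * (P * A))"
      unfolding D using A P Q by (intro trace2_mult_commute) auto
    also have "Q * (P * A) = A" using A P Q QP
      by (metis assoc_mult_mat left_mult_one_mat)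
    finally show ?thesis .
  qed
  have conj: "P * (B * C) * Q = (P * B * Q) * (P * C * Q)"
    if "B \<in> carrier_mat 2 2" "C \<in> carrier_mat 2 2" for B C
  proof -
    have "(P * B * Q) * (P * C * Q) = P * (B * ((Q * P) * (C * Q)))"
      using that P Q by (simp add: assoc_mult_mat[of _ 2 2 _ 2 _ 2])
    then show ?thesis using that P Q QP by (simp add: assoc_mult_mat[of _ 2 2 _ 2 _ 2])
  qed
  have conj_affine: "P * (r \<cdot>\<^sub>m B - s \<cdot>\<^sub>m 1\<^sub>m 2) * Q = r \<cdot>\<^sub>m (P * B * Q) - s \<cdot>\<^sub>m 1\<^sub>m 2"
    if "B \<in> carrier_mat 2 2" for B and r s :: complex
  proof -
    have "P * (r \<cdot>\<^sub>m B - s \<cdot>\<^sub>m 1\<^sub>m 2) = r \<cdot>\<^sub>m (P * B) - s \<cdot>\<^sub>m P"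
      using that P by (subst mult_minus_distrib_mat[of _ 2 2 _ 2])
        (simp_all add: mult_smult_distrib[of _ 2 2 _ 2])
    then show ?thesis
      using that P Q PQ by (simp add: minus_mult_distrib_mat[of _ 2 2 _ _ 2]
          mult_smult_assoc_mat[of _ 2 2 _ 2])
  qed
  have DD: "D * D = ?t \<cdot>\<^sub>m D - det2 A \<cdot>\<^sub>m 1\<^sub>m 2"
    using conj[OF A A] conj_affine[OF A] cayley_hamilton2[OF A] by (simp add: D)
  have det: "det2 D = det2 A"
  proof -
    have "(?t \<cdot>\<^sub>m D - det2 A \<cdot>\<^sub>m 1\<^sub>m 2) $$ (0, 0) = (?t \<cdot>\<^sub>m D - det2 D \<cdot>\<^sub>m 1\<^sub>m 2) $$ (0, 0)"
      using DD cayley_hamilton2[OF Dc] tr by simp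
    then show ?thesis using Dc by simp
  qed
  define a b c d where "a = A $$ (0, 0)" and "b = A $$ (0, 1)" and "c = A $$ (1, 0)" and "d = A $$ (1, 1)"
  then have A_entries: "A $$ (0, 0) = a" "A $$ (0, Suc 0) = b" "A $$ (Suc 0, 0) = c" "A $$ (Suc 0, Suc 0) = d"
    by simp_all
  define x y z where "x = D $$ (0, 0) - a" and "y = D $$ (0, 1) - b" and "z = D $$ (1, 0) - c"
  have D_entries: "D $$ (0, 0) = a + x" "D $$ (0, Suc 0) = b + y" "D $$ (Suc 0, 0) = c + z"
    "D $$ (Suc 0, Suc 0) = d - x"
    using tr by (simp_all add: x_def y_def z_def trace2_def A_entries algebra_simps)
  have com: "(A * D) $$ (i, j) = (D * A) $$ (i, j)" for i j using comm by simp
  have c1: "b * z = y * c" and c2: "a * y - b * x = x * b + y * d" and c3: "c * x + d * z = z * a - x * c"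
    using com[of 0 0] com[of 0 1] com[of 1 0] A Dc
    by (simp_all add: mult_mat2_index D_entries A_entries algebra_simps del: index_mult_mat(1))
  have d1: "(a + x) * (d - x) - (b + y) * (c + z) = a * d - b * c"
    using det by (simp add: det2_def D_entries A_entries)
  show ?thesis
  proof (cases "x * x + y * z = 0")
    case True
    then have "(D - A) * (D - A) = 0\<^sub>m 2 2"
      using A Dc
      by (intro eq_mat2I) (auto simp: mult_mat2_index minus_carrier_mat D_entries A_entries algebra_simps simp del: index_mult_mat(1))
    then show ?thesis ..
  next
    case False
    \<comment> \<open>The entries of \<open>N (D + A - t) = 0\<close>; multiplying by \<open>N\<close> once more isolates the entries of
      \<open>D + A - t\<close>, each times the scalar \<open>x\<^sup>2 + y z = - det N\<close>.\<close>
    let ?e = "a + x - d"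
    have n1: "x * ?e + y * (2 * c + z) = 0" and n2: "z * ?e - x * (2 * c + z) = 0"
      and n3: "x * (2 * b + y) - y * ?e = 0" and n4: "z * (2 * b + y) + x * ?e = 0"
      using c1 c2 c3 d1 by (simp_all add: algebra_simps)
    have "(x * x + y * z) * ?e = x * (x * ?e + y * (2 * c + z)) + y * (z * ?e - x * (2 * c + z))"
      "(x * x + y * z) * (2 * b + y) = x * (x * (2 * b + y) - y * ?e) + y * (z * (2 * b + y) + x * ?e)"
      "(x * x + y * z) * (2 * c + z) = z * (x * ?e + y * (2 * c + z)) - x * (z * ?e - x * (2 * c + z))"
      by (simp_all add: algebra_simps)
    then have "(x * x + y * z) * ?e = 0" "(x * x + y * z) * (2 * b + y) = 0"
      "(x * x + y * z) * (2 * c + z) = 0"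
      unfolding n1 n2 n3 n4 by simp_all
    then have "a + x = d" "2 * b + y = 0" "2 * c + z = 0" using False by auto
    then have *: "D = (- 1) \<cdot>\<^sub>m A - (- ?t) \<cdot>\<^sub>m 1\<^sub>m 2"
      using A Dc
      by (intro eq_mat2I) (auto simp: D_entries trace2_def A_entries algebra_simps)
    have "P * D * Q = (- 1) \<cdot>\<^sub>m D - (- ?t) \<cdot>\<^sub>m 1\<^sub>m 2"
      by (subst *) (simp only: conj_affine[OF A] D)
    also have "\<dots> = A"
      using A Dc by (subst *) (intro eq_mat2I, auto)
    finally show ?thesis ..
  qed
qed

text \<open>If \<open>N\<^sup>2 = 0\<close> then \<open>(1 + N)\<^sup>k = 1 + k N\<close>, and in characteristic 0 this is 1 for some \<open>k > 0\<close> only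
  if \<open>N = 0\<close>.\<close>

lemma (in group) unipotent_imp_one:
  assumes \<rho>: "\<rho> \<in> hom G (GL n)" and inj: "inj_on \<rho> (carrier G)" and fin: "finite (carrier G)"
    and f: "f \<in> carrier G"
    and sq: "(\<rho> f - 1\<^sub>m n) * (\<rho> f - 1\<^sub>m n) = 0\<^sub>m n n"
  shows "f = \<one>"
proof -
  define N where "N = \<rho> f - 1\<^sub>m n"
  have dim: "\<rho> x \<in> carrier_mat n n" if "x \<in> carrier G" for x
    using that \<rho> by (auto simp: hom_def intro: GL_carrierD)
  have one: "\<rho> \<one> = 1\<^sub>m n" using hom_one[OF \<rho> is_group group_GL] by (simp add: GL_one)
  have F: "\<rho> f \<in> carrier_mat n n" using dim f by blast
  have N: "N \<in> carrier_mat n n" unfolding N_def by (intro minus_carrier_mat one_carrier_mat)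
  have NN: "N * N = 0\<^sub>m n n" using sq by (simp add: N_def)
  have FN: "\<rho> f = 1\<^sub>m n + N" unfolding N_def using F by (intro eq_matI) auto
  have pow: "\<rho> (f [^] (k::nat)) = 1\<^sub>m n + of_nat k \<cdot>\<^sub>m N" for k
  proof (induction k)
    case 0
    then show ?case using N by (simp add: one) (intro eq_matI, auto)
  next
    case (Suc k)
    have "\<rho> (f [^] Suc k) = (1\<^sub>m n + of_nat k \<cdot>\<^sub>m N) * (1\<^sub>m n + N)"
      using hom_mult[OF \<rho>] f Suc FN by (simp add: GL_mult)
    also have "\<dots> = (1\<^sub>m n + of_nat k \<cdot>\<^sub>m N) + (N + of_nat k \<cdot>\<^sub>m (N * N))"
      using N by (simp add: add_mult_distrib_mat[of _ n n _ _ n]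
          mult_add_distrib_mat[of _ n n _ n] mult_smult_assoc_mat[of _ n n _ n])
    also have "\<dots> = 1\<^sub>m n + of_nat (Suc k) \<cdot>\<^sub>m N"
      using N unfolding NN by (intro eq_matI) (auto simp: algebra_simps)
    finally show ?case .
  qed
  have ord: "ord f > 0" using ord_ge_1[OF fin f] by simp
  have "1\<^sub>m n + of_nat (ord f) \<cdot>\<^sub>m N = 1\<^sub>m n"
    using pow[of "ord f"] f by (simp add: one)
  then have eq: "(1\<^sub>m n + of_nat (ord f) \<cdot>\<^sub>m N) $$ (i, j) = 1\<^sub>m n $$ (i, j)" for i j by simp
  have "\<rho> f = \<rho> \<one>"
  proof (rule eq_matI)
    fix i j assume "i < dim_row (\<rho> \<one>)" "j < dim_col (\<rho> \<one>)"
    then have ij: "i < n" "j < n" by (simp_all add: one)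
    then have "N $$ (i, j) = 0" using eq[of i j] N ord by simp
    then show "\<rho> f $$ (i, j) = \<rho> \<one> $$ (i, j)"
      using ij F by (simp add: N_def one)
  qed (use F in \<open>simp_all add: one\<close>)
  then show ?thesis using inj f by (auto dest: inj_onD)
qed

text \<open>Let \<open>e = g c g\<^sup>-\<^sup>1\<close>. The two alternatives of \<open>mat2_commuting_conjugate\<close> become \<open>e = c\<close>, because
  \<open>e c\<^sup>-\<^sup>1\<close> is unipotent of finite order, and \<open>g e g\<^sup>-\<^sup>1 = c\<close>.\<close>

lemma (in group) faithful_dim2_square_commutes:
  assumes \<rho>: "\<rho> \<in> hom G (GL 2)" and inj: "inj_on \<rho> (carrier G)" and fin: "finite (carrier G)"
    and g: "g \<in> carrier G" and c: "c \<in> carrier G"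
    and comm: "c \<otimes> (g \<otimes> c \<otimes> inv g) = (g \<otimes> c \<otimes> inv g) \<otimes> c"
  shows "(g \<otimes> g) \<otimes> c = c \<otimes> (g \<otimes> g)"
proof -
  have dim: "\<rho> x \<in> carrier_mat 2 2" if "x \<in> carrier G" for x
    using that \<rho> by (auto simp: hom_def intro: GL_carrierD)
  have one: "\<rho> \<one> = 1\<^sub>m 2" using hom_one[OF \<rho> is_group group_GL] by (simp add: GL_one)
  have mult: "\<rho> (x \<otimes> y) = \<rho> x * \<rho> y" if "x \<in> carrier G" "y \<in> carrier G" for x y
    using hom_mult[OF \<rho> that] by (simp add: GL_mult)
  define e where "e = g \<otimes> c \<otimes> inv g"
  have e: "e \<in> carrier G" using g c by (simp add: e_def)
  have ge: "g \<otimes> c = e \<otimes> g" using g c by (simp add: e_def m_assoc)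
  have "(\<rho> e - \<rho> c) * (\<rho> e - \<rho> c) = 0\<^sub>m 2 2 \<or> \<rho> g * \<rho> e * \<rho> (inv g) = \<rho> c"
  proof (rule mat2_commuting_conjugate)
    show "\<rho> g * \<rho> (inv g) = 1\<^sub>m 2" "\<rho> (inv g) * \<rho> g = 1\<^sub>m 2"
      using g by (simp_all add: one flip: mult)
    show "\<rho> e = \<rho> g * \<rho> c * \<rho> (inv g)" using g c by (simp add: e_def mult)
    show "\<rho> c * \<rho> e = \<rho> e * \<rho> c" using comm c e by (simp add: e_def flip: mult)
  qed (use dim g c in auto)
  then show ?thesis
  proof
    assume 0: "(\<rho> e - \<rho> c) * (\<rho> e - \<rho> c) = 0\<^sub>m 2 2"
    let ?I = "\<rho> (inv c)" and ?M = "\<rho> e - \<rho> c"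
    have I: "?I \<in> carrier_mat 2 2" and M: "?M \<in> carrier_mat 2 2"
      using dim c e by (simp_all add: minus_carrier_mat)
    have ic: "inv c \<otimes> e = e \<otimes> inv c"
      using comm c e by (metis e_def inv_closed inv_solve_left' inv_solve_right m_assoc m_closed)
    have "?I * \<rho> e = \<rho> e * ?I" "?I * \<rho> c = \<rho> c * ?I"
      using c e ic by (simp_all flip: mult)
    then have IM: "?I * ?M = ?M * ?I"
      using dim[OF c] dim[OF e] I
      by (simp add: mult_minus_distrib_mat[of _ 2 2 _ 2] minus_mult_distrib_mat[of _ 2 2 _ _ 2])
    have "\<rho> (e \<otimes> inv c) - 1\<^sub>m 2 = ?M * ?I"
      using dim[OF c] dim[OF e] I e c
      by (simp add: minus_mult_distrib_mat[of _ 2 2 _ _ 2] mult) (simp add: one flip: mult)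
    moreover have "(?M * ?I) * (?M * ?I) = 0\<^sub>m 2 2"
    proof -
      have "(?M * ?I) * (?M * ?I) = ?M * ((?I * ?M) * ?I)"
        using I M by (simp add: assoc_mult_mat[of _ 2 2 _ 2 _ 2])
      also have "\<dots> = (?M * ?M) * (?I * ?I)"
        unfolding IM using I M by (simp add: assoc_mult_mat[of _ 2 2 _ 2 _ 2])
      also have "\<dots> = 0\<^sub>m 2 2" unfolding 0 using I by simp
      finally show ?thesis .
    qed
    ultimately have "e \<otimes> inv c = \<one>"
      using unipotent_imp_one[OF \<rho> inj fin, of "e \<otimes> inv c"] e c by simp
    then have "e = c" using e c by (metis inv_equality inv_closed inv_inv)
    then have "g \<otimes> c = c \<otimes> g" using ge by simp
    then show ?thesis using g c by (metis m_assoc)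
  next
    assume "\<rho> g * \<rho> e * \<rho> (inv g) = \<rho> c"
    then have "\<rho> (g \<otimes> e \<otimes> inv g) = \<rho> c" using g e by (simp add: mult)
    then have "g \<otimes> e \<otimes> inv g = c" using inj g e c by (auto dest: inj_onD)
    then have "g \<otimes> e = c \<otimes> g" using g e c by (metis inv_solve_right m_closed)
    then show ?thesis using g c e ge by (metis m_assoc)
  qed
qed

section \<open>Groups with the presentation of the theorem\<close>

definition eval_letter :: "('k, 'm) monoid_scheme \<Rightarrow> ('x \<Rightarrow> 'k) \<Rightarrow> bool \<times> 'x \<Rightarrow> 'k" where
  "eval_letter K f l = (if fst l then f (snd l) else inv\<^bsub>K\<^esub> f (snd l))"

definition eval_word :: "('k, 'm) monoid_scheme \<Rightarrow> ('x \<Rightarrow> 'k) \<Rightarrow> 'x word \<Rightarrow> 'k" where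
  "eval_word K f w = foldr (\<lambda>l y. eval_letter K f l \<otimes>\<^bsub>K\<^esub> y) w \<one>\<^bsub>K\<^esub>"

lemma eval_word_Nil [simp]: "eval_word K f [] = \<one>\<^bsub>K\<^esub>"
  by (simp add: eval_word_def)

lemma eval_word_Cons [simp]: "eval_word K f (l # w) = eval_letter K f l \<otimes>\<^bsub>K\<^esub> eval_word K f w"
  by (simp add: eval_word_def)

context group
begin

lemma eval_letter_closed: "range f \<subseteq> carrier G \<Longrightarrow> eval_letter G f l \<in> carrier G"
  by (auto simp: eval_letter_def)

lemma eval_word_closed: "range f \<subseteq> carrier G \<Longrightarrow> eval_word G f w \<in> carrier G"
  by (induction w) (auto intro: eval_letter_closed)

lemma eval_word_append:
  "range f \<subseteq> carrier G \<Longrightarrow> eval_word G f (u @ v) = eval_word G f u \<otimes> eval_word G f v"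
  by (induction u) (auto simp: eval_letter_closed eval_word_closed m_assoc)

lemma eval_word_cancels:
  assumes "cancels u v" "range f \<subseteq> carrier G"
  shows "eval_word G f u = eval_word G f v"
  using assms
proof (induction rule: cancels.induct)
  case (1 u s x v)
  have "f x \<in> carrier G" using 1 by auto
  then have "eval_letter G f (s, x) \<otimes> (eval_letter G f (\<not> s, x) \<otimes> eval_word G f v) = eval_word G f v"
    by (cases s) (simp_all add: eval_letter_def eval_word_closed 1 flip: m_assoc)
  then show ?case using 1 by (simp add: eval_word_append)
qed

lemma eval_word_free_rel:
  assumes "(u, v) \<in> free_rel" "range f \<subseteq> carrier G"
  shows "eval_word G f u = eval_word G f v"
proof -
  have "equivclp cancels u v" using assms by (simp add: free_rel_def)
  then show ?thesis
    by (induction rule: equivclp_induct) (use eval_word_cancels assms(2) in \<open>metis\<close>)+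
qed

text \<open>The universal property of the free group: inserting or deleting a cancelling pair does not change
  the value of a word, so evaluation is well defined on classes of words.\<close>

lemma free_group_universal:
  fixes f :: "'x \<Rightarrow> 'a"
  assumes f: "range f \<subseteq> carrier G"
  obtains \<phi> where "\<phi> \<in> hom free_group G" "\<And>x. \<phi> (free_gen x) = f x"
proof
  let ?\<phi> = "\<lambda>U. eval_word G f (SOME u. u \<in> U)"
  have cls: "?\<phi> (free_rel `` {u}) = eval_word G f u" for u
  proof -
    have "u \<in> free_rel `` {u}" using equiv_class_self[OF equiv_free_rel] by blast
    then have "(SOME v. v \<in> free_rel `` {u}) \<in> free_rel `` {u}" by (rule someI)
    then show ?thesis using eval_word_free_rel[OF _ f] by fastforce
  qed
  show "?\<phi> \<in> hom free_group G"
  proof (rule homI)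
    fix U V :: "'x word set" assume U: "U \<in> carrier free_group" and V: "V \<in> carrier free_group"
    from U V obtain u v where "U = free_rel `` {u}" "V = free_rel `` {v}"
      by (meson free_group_carrierE)
    then show "?\<phi> (U \<otimes>\<^bsub>free_group\<^esub> V) = ?\<phi> U \<otimes> ?\<phi> V"
      by (simp only: free_mult_class cls eval_word_append[OF f])
  qed (simp add: eval_word_closed f)
  show "?\<phi> (free_gen x) = f x" for x
    using f unfolding free_gen_def cls by (simp add: eval_letter_def image_subset_iff)
qed

lemma inverted_conj_pow:
  assumes "a \<in> carrier G" "b \<in> carrier G" "b \<otimes> a \<otimes> inv b \<otimes> a = \<one>" "a [^] (p::nat) = \<one>" "p > 0"
  shows "b \<otimes> a [^] (i::nat) = a [^] ((p - 1) * i) \<otimes> b"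
proof -
  have 1: "a [^] (p - 1) \<otimes> a = \<one>" using assms
    by (metis One_nat_def Suc_pred nat_pow_Suc)
  have "b \<otimes> a \<otimes> inv b = inv a"
    using assms by (metis inv_closed inv_equality m_closed)
  also have "\<dots> = a [^] (p - 1)"
    using 1 assms by (metis inv_equality nat_pow_closed)
  finally have *: "b \<otimes> a = a [^] (p - 1) \<otimes> b"
    using assms by (metis inv_solve_right' m_closed nat_pow_closed)
  show ?thesis
  proof (induction i)
    case (Suc i)
    have "b \<otimes> a [^] Suc i = (b \<otimes> a [^] i) \<otimes> a"
      using assms by (simp add: m_assoc)
    also have "\<dots> = a [^] ((p - 1) * i) \<otimes> (b \<otimes> a)"
      using assms by (simp add: Suc m_assoc)
    also have "\<dots> = a [^] ((p - 1) * i) \<otimes> a [^] (p - 1) \<otimes> b"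
      using assms by (simp add: * m_assoc)
    also have "\<dots> = a [^] ((p - 1) * Suc i) \<otimes> b"
      using assms by (simp add: nat_pow_mult algebra_simps)
    finally show ?case .
  qed (use assms in simp)
qed

text \<open>The relations let every \<open>b\<close> be moved to the right of every \<open>a\<close>. This makes the normal form
  \<open>a\<^sup>i b\<^sup>j\<close> stable under left multiplication, in the presented group as well as in any other group
  in which the relations hold.\<close>

lemma inverted_left_mult:
  assumes "a \<in> carrier G" "b \<in> carrier G" "b \<otimes> a \<otimes> inv b \<otimes> a = \<one>" "a [^] (p::nat) = \<one>" "p > 0"
  shows "\<exists>(i'::nat) (j'::nat). b [^] (k::nat) \<otimes> (a [^] (i::nat) \<otimes> b [^] (j::nat)) = a [^] i' \<otimes> b [^] j'"
proof (induction k)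
  case 0
  have "b [^] (0::nat) \<otimes> (a [^] i \<otimes> b [^] j) = a [^] i \<otimes> b [^] j" using assms by simp
  then show ?case by blast
next
  case (Suc k)
  then obtain i' j' :: nat where "b [^] k \<otimes> (a [^] i \<otimes> b [^] j) = a [^] i' \<otimes> b [^] j'" by auto
  moreover have "b [^] Suc k \<otimes> (a [^] i \<otimes> b [^] j) = b \<otimes> (b [^] k \<otimes> (a [^] i \<otimes> b [^] j))"
    using assms(1,2) by (subst nat_pow_Suc2) (simp_all only: m_assoc m_closed nat_pow_closed)
  ultimately have "b [^] Suc k \<otimes> (a [^] i \<otimes> b [^] j) = b \<otimes> a [^] i' \<otimes> b [^] j'"
    using assms(1,2) by (simp only: m_assoc m_closed nat_pow_closed)
  also have "\<dots> = a [^] ((p - 1) * i') \<otimes> b [^] Suc j'"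
    using assms(1,2)
    by (simp only: inverted_conj_pow[OF assms] m_assoc m_closed nat_pow_closed nat_pow_Suc2)
  finally show ?case by blast
qed

lemma eval_word_normal_form:
  assumes ab: "f gen_a = a" "f gen_b = b" "a \<in> carrier G" "b \<in> carrier G"
    and rels: "b \<otimes> a \<otimes> inv b \<otimes> a = \<one>" "a [^] (p::nat) = \<one>" "p > 0" "b [^] (n::nat) = \<one>" "n > 0"
  obtains i j :: nat where "i < p" "j < n" "eval_word G f w = a [^] i \<otimes> b [^] j"
proof -
  have inva: "inv a = a [^] (p - 1)" and invb: "inv b = b [^] (n - 1)"
    using assms by (metis One_nat_def Suc_pred inv_equality nat_pow_Suc nat_pow_closed)+
  have left_b: "\<exists>i' j'. b [^] k \<otimes> (a [^] i \<otimes> b [^] j) = a [^] (i'::nat) \<otimes> b [^] (j'::nat)"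
    for i j k :: nat
    using inverted_left_mult assms by blast
  have left_a: "\<exists>i' j'. a [^] k \<otimes> (a [^] i \<otimes> b [^] j) = a [^] (i'::nat) \<otimes> b [^] (j'::nat)"
    for i j k :: nat
    using assms by (metis nat_pow_mult m_assoc nat_pow_closed)
  have "\<exists>i j. eval_word G f w = a [^] (i::nat) \<otimes> b [^] (j::nat)"
  proof (induction w)
    case Nil
    have "\<one> = a [^] (0::nat) \<otimes> b [^] (0::nat)" by simp
    then show ?case unfolding eval_word_Nil by blast
  next
    case (Cons l w)
    have "\<exists>k. eval_letter G f l = a [^] (k::nat) \<or> eval_letter G f l = b [^] (k::nat)"
    proof (cases "snd l")
      case gen_a
      then show ?thesis
        by (metis ab(1,3) eval_letter_def inva nat_pow_eone)
    next
      case gen_b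
      then show ?thesis
        by (metis ab(2,4) eval_letter_def invb nat_pow_eone)
    qed
    with Cons show ?case using left_a left_b by (metis eval_word_Cons)
  qed
  then obtain i j :: nat where *: "eval_word G f w = a [^] i \<otimes> b [^] j" by blast
  have "x [^] (i mod k) = x [^] i" if "x \<in> carrier G" "x [^] k = \<one>" for x and i k :: nat
    using that
    by (metis div_mod_decomp mult.commute nat_pow_closed nat_pow_mult nat_pow_one nat_pow_pow l_one)
  with * assms have "eval_word G f w = a [^] (i mod p) \<otimes> b [^] (j mod n)" by simp
  with that assms show ?thesis by (meson mod_less_divisor)
qed

end

lemma eval_word_hom:
  assumes "group K" "group L" "h \<in> hom K L" "range f \<subseteq> carrier K"
  shows "h (eval_word K f w) = eval_word L (h \<circ> f) w"
proof -
  interpret group_hom K L h using assms by (simp add: group_hom_def group_hom_axioms_def)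
  show ?thesis
    using assms(4)
  proof (induction w)
    case (Cons l w)
    have "f (snd l) \<in> carrier K" using Cons by auto
    then show ?case using Cons by (simp add: eval_letter_def G.eval_word_closed)
  qed simp
qed

lemma eval_word_free_gen: "eval_word free_group free_gen w = free_rel `` {w}"
proof (induction w)
  case Nil
  then show ?case by (simp add: free_one)
next
  case (Cons l w)
  obtain s x where l: "l = (s, x)" by force
  have inv: "inv\<^bsub>free_group\<^esub> (free_gen x) = free_rel `` {[(False, x)]}"
  proof (rule group.inv_equality[OF group_free_group])
    show "free_rel `` {[(False, x)]} \<otimes>\<^bsub>free_group\<^esub> free_gen x = \<one>\<^bsub>free_group\<^esub>"
      using equiv_class_eq[OF equiv_free_rel free_inverse[of "[(True, x)]"]]
      by (simp add: free_gen_def free_mult_class free_one)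
  qed (simp_all add: free_gen_def)
  have "eval_letter free_group free_gen l = free_rel `` {[l]}"
    by (cases s) (simp_all add: l eval_letter_def inv, simp add: free_gen_def)
  then show ?case by (simp add: Cons free_mult_class)
qed

text \<open>The kernel of the map from the free group to \<open>K\<close> is the normal closure of the relators: modulo
  the normal closure every word has a normal form \<open>a\<^sup>i b\<^sup>j\<close> with \<open>i < p\<close> and \<open>j < 2\<^sup>m\<close>, and by
  assumption only the trivial normal form is mapped to 1 in \<open>K\<close>. The first isomorphism theorem does
  the rest. The lemma serves both for \<open>G\<close> itself and for the semidirect product.\<close>

lemma presented_G_iso:
  fixes K :: "('k, 'm) monoid_scheme"
  assumes K: "group K" and a: "a \<in> carrier K" and b: "b \<in> carrier K"
    and "p > 0"
    and rels: "a [^]\<^bsub>K\<^esub> p = \<one>\<^bsub>K\<^esub>" "b [^]\<^bsub>K\<^esub> ((2::nat) ^ m) = \<one>\<^bsub>K\<^esub>"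
      "b \<otimes>\<^bsub>K\<^esub> a \<otimes>\<^bsub>K\<^esub> inv\<^bsub>K\<^esub> b \<otimes>\<^bsub>K\<^esub> a = \<one>\<^bsub>K\<^esub>"
    and gen: "\<And>x. x \<in> carrier K \<Longrightarrow> \<exists>(i::nat) (j::nat). x = a [^]\<^bsub>K\<^esub> i \<otimes>\<^bsub>K\<^esub> b [^]\<^bsub>K\<^esub> j"
    and uniq: "\<And>i j :: nat. i < p \<Longrightarrow> j < 2 ^ m \<Longrightarrow>
      a [^]\<^bsub>K\<^esub> i \<otimes>\<^bsub>K\<^esub> b [^]\<^bsub>K\<^esub> j = \<one>\<^bsub>K\<^esub> \<Longrightarrow> i = 0 \<and> j = 0"
  shows "presented_G p m \<cong> K"
proof -
  let ?F = "free_group :: gen_ab word set monoid"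
  let ?A = "free_gen gen_a" and ?B = "free_gen gen_b"
  define R where "R = {?A [^]\<^bsub>?F\<^esub> p, ?B [^]\<^bsub>?F\<^esub> ((2::nat) ^ m),
    ?B \<otimes>\<^bsub>?F\<^esub> ?A \<otimes>\<^bsub>?F\<^esub> inv\<^bsub>?F\<^esub> ?B \<otimes>\<^bsub>?F\<^esub> ?A}"
  define N where "N = normal_closure ?F R"
  interpret K: group K by fact
  interpret F: group ?F by (rule group_free_group)
  have gcl: "free_gen x \<in> carrier ?F" for x by (simp add: free_gen_def)
  have RF: "R \<subseteq> carrier ?F" by (auto simp: R_def gcl)
  interpret N: normal N ?F
    unfolding N_def by (rule F.normal_closure_normal[OF RF])
  define f where "f x = (case x of gen_a \<Rightarrow> a | gen_b \<Rightarrow> b)" for x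
  have f: "f gen_a = a" "f gen_b = b" by (simp_all add: f_def)
  have rf: "range f \<subseteq> carrier K" using a b by (auto simp: f_def split: gen_ab.splits)
  obtain \<phi> where \<phi>: "\<phi> \<in> hom ?F K" "\<And>x. \<phi> (free_gen x) = f x"
    by (rule K.free_group_universal[OF rf]) blast
  interpret \<phi>: group_hom ?F K \<phi>
    using \<phi> K F.is_group by (simp add: group_hom_def group_hom_axioms_def)
  have \<phi>V: "\<phi> (?A [^]\<^bsub>?F\<^esub> i \<otimes>\<^bsub>?F\<^esub> ?B [^]\<^bsub>?F\<^esub> j) = a [^]\<^bsub>K\<^esub> i \<otimes>\<^bsub>K\<^esub> b [^]\<^bsub>K\<^esub> j"
    for i j :: nat
    using gcl by (simp add: \<phi> f \<phi>.hom_nat_pow)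
  let ?N = "kernel ?F K \<phi>"
  have R_ker: "R \<subseteq> ?N"
    using rels by (auto simp: R_def kernel_def gcl \<phi> f \<phi>.hom_nat_pow)
  have "N \<subseteq> ?N"
    unfolding N_def normal_closure_def using \<phi>.normal_kernel R_ker by blast
  moreover have "?N \<subseteq> N"
  proof
    fix U assume U: "U \<in> ?N"
    then have UF: "U \<in> carrier ?F" by (simp add: kernel_def)
    then obtain w where w: "U = eval_word ?F free_gen w"
      unfolding eval_word_free_gen by (rule free_group_carrierE)
    \<comment> \<open>\<open>?Q\<close> is the presented group; its generators satisfy the relations, so the value of \<open>w\<close> in it
      has a normal form.\<close>
    let ?Q = "?F Mod N"
    let ?\<pi> = "\<lambda>x. N #>\<^bsub>?F\<^esub> x"
    have Q: "group ?Q" by (rule N.factorgroup_is_group)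
    interpret \<pi>: group_hom ?F ?Q ?\<pi>
      using N.r_coset_hom_Mod Q F.is_group by (simp add: group_hom_def group_hom_axioms_def)
    have RN: "R \<subseteq> N" unfolding N_def normal_closure_def by blast
    have triv: "?\<pi> x = \<one>\<^bsub>?Q\<^esub> \<longleftrightarrow> x \<in> N" if "x \<in> carrier ?F" for x
      using that N.subgroup_axioms by (metis F.coset_join1 F.coset_join2 N.subset one_FactGroup)
    have rQ: "?\<pi> r = \<one>\<^bsub>?Q\<^esub>" if "r \<in> R" for r
      using that RN RF triv by blast
    obtain i j :: nat where ij: "i < p" "j < 2 ^ m"
      "eval_word ?Q (?\<pi> \<circ> free_gen) w = ?\<pi> ?A [^]\<^bsub>?Q\<^esub> i \<otimes>\<^bsub>?Q\<^esub> ?\<pi> ?B [^]\<^bsub>?Q\<^esub> j"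
    proof (rule group.eval_word_normal_form[OF Q, where f = "?\<pi> \<circ> free_gen"])
      show "?\<pi> ?B \<otimes>\<^bsub>?Q\<^esub> ?\<pi> ?A \<otimes>\<^bsub>?Q\<^esub> inv\<^bsub>?Q\<^esub> ?\<pi> ?B \<otimes>\<^bsub>?Q\<^esub> ?\<pi> ?A = \<one>\<^bsub>?Q\<^esub>"
        using rQ[of "?B \<otimes>\<^bsub>?F\<^esub> ?A \<otimes>\<^bsub>?F\<^esub> inv\<^bsub>?F\<^esub> ?B \<otimes>\<^bsub>?F\<^esub> ?A"]
        by (simp add: R_def gcl del: mult_FactGroup)
      show "?\<pi> ?A [^]\<^bsub>?Q\<^esub> p = \<one>\<^bsub>?Q\<^esub>"
        using rQ[of "?A [^]\<^bsub>?F\<^esub> p"] by (simp add: R_def gcl \<pi>.hom_nat_pow)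
      show "?\<pi> ?B [^]\<^bsub>?Q\<^esub> ((2::nat) ^ m) = \<one>\<^bsub>?Q\<^esub>"
        using rQ[of "?B [^]\<^bsub>?F\<^esub> ((2::nat) ^ m)"] by (simp add: R_def gcl \<pi>.hom_nat_pow)
    qed (use \<open>p > 0\<close> gcl in \<open>auto\<close>)
    let ?V = "?A [^]\<^bsub>?F\<^esub> i \<otimes>\<^bsub>?F\<^esub> ?B [^]\<^bsub>?F\<^esub> j"
    have VF: "?V \<in> carrier ?F" using gcl by simp
    have "?\<pi> U = ?\<pi> (?A [^]\<^bsub>?F\<^esub> i \<otimes>\<^bsub>?F\<^esub> ?B [^]\<^bsub>?F\<^esub> j)"
      using ij(3) gcl eval_word_hom[OF F.is_group Q \<pi>.homh, of free_gen w]
      by (auto simp: w \<pi>.hom_nat_pow simp del: mult_FactGroup)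
    moreover have "U \<in> ?\<pi> U" using UF N.subgroup_axioms by (rule F.rcos_self)
    ultimately have UV: "U \<otimes>\<^bsub>?F\<^esub> inv\<^bsub>?F\<^esub> ?V \<in> N"
      using N.rcos_module[OF F.is_group VF UF] by simp
    have "\<phi> U \<otimes>\<^bsub>K\<^esub> inv\<^bsub>K\<^esub> \<phi> ?V = \<phi> (U \<otimes>\<^bsub>?F\<^esub> inv\<^bsub>?F\<^esub> ?V)"
      using UF VF by (simp only: \<phi>.hom_mult \<phi>.hom_inv F.inv_closed)
    also have "\<dots> = \<one>\<^bsub>K\<^esub>" using UV \<open>N \<subseteq> ?N\<close> by (auto simp: kernel_def)
    finally have "inv\<^bsub>K\<^esub> (a [^]\<^bsub>K\<^esub> i \<otimes>\<^bsub>K\<^esub> b [^]\<^bsub>K\<^esub> j) = \<one>\<^bsub>K\<^esub>"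
      using U a b by (simp add: kernel_def \<phi>V)
    then have "a [^]\<^bsub>K\<^esub> i \<otimes>\<^bsub>K\<^esub> b [^]\<^bsub>K\<^esub> j = \<one>\<^bsub>K\<^esub>"
      using a b by simp
    then have "i = 0 \<and> j = 0" using uniq ij by blast
    then show "U \<in> N" using UV UF by simp
  qed
  ultimately have "?N = N" by blast
  then have "presented_G p m = ?F Mod ?N"
    by (simp only: presented_G_def presented_group_def Let_def N_def R_def)
  moreover have "\<phi> ` carrier ?F = carrier K"
  proof (rule subset_antisym)
    show "carrier K \<subseteq> \<phi> ` carrier ?F"
    proof (rule subsetI)
      fix x assume "x \<in> carrier K"
      from gen[OF this] obtain i j :: nat where "x = a [^]\<^bsub>K\<^esub> i \<otimes>\<^bsub>K\<^esub> b [^]\<^bsub>K\<^esub> j" by blast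
      then have "x = \<phi> (?A [^]\<^bsub>?F\<^esub> i \<otimes>\<^bsub>?F\<^esub> ?B [^]\<^bsub>?F\<^esub> j)"
        by (simp only: \<phi>V)
      moreover have "?A [^]\<^bsub>?F\<^esub> i \<otimes>\<^bsub>?F\<^esub> ?B [^]\<^bsub>?F\<^esub> j \<in> carrier ?F"
        using gcl by (intro F.m_closed F.nat_pow_closed)
      ultimately show "x \<in> \<phi> ` carrier ?F" by (rule image_eqI)
    qed
    show "\<phi> ` carrier ?F \<subseteq> carrier K" using \<phi>.hom_closed by (rule image_subsetI)
  qed
  ultimately show ?thesis using \<phi>.FactGroup_iso by (simp only:)
qed

section \<open>The semidirect product\<close>

context
  fixes p m :: nat
  assumes p: "p > 0" and m: "m \<ge> 1"
begin

lemma semidirect_G_carrier: "carrier (semidirect_G p m) = {0..<int p} \<times> {0..<2 ^ m}"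
  using p by (simp add: semidirect_G_def semidirect_product_def carrier_integer_mod_group)

lemma semidirect_G_one: "\<one>\<^bsub>semidirect_G p m\<^esub> = (0, 0)"
  by (simp add: semidirect_G_def semidirect_product_def)

lemma semidirect_G_mult:
  assumes "0 \<le> x'" "x' < int p"
  shows "(x, j) \<otimes>\<^bsub>semidirect_G p m\<^esub> (x', j') =
    ((x + (if even j then x' else - x')) mod int p, (j + j') mod 2 ^ m)"
  using assms p
  by (auto simp: semidirect_G_def semidirect_product_def inversion_action_def
      carrier_integer_mod_group mod_simps)

text \<open>The action of the second factor depends only on parity, which survives reduction modulo \<open>2\<^sup>m\<close>
  because \<open>m \<ge> 1\<close>.\<close>

lemma even_mod_two_power: "even ((j :: int) mod 2 ^ m) \<longleftrightarrow> even j"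
  using m by (intro dvd_mod_iff) simp

lemma group_semidirect_G: "group (semidirect_G p m)"
proof (rule groupI)
  let ?S = "semidirect_G p m"
  show "u \<otimes>\<^bsub>?S\<^esub> v \<in> carrier ?S" if "u \<in> carrier ?S" "v \<in> carrier ?S" for u v
    using that p by (auto simp: semidirect_G_carrier semidirect_G_mult)
  show "u \<otimes>\<^bsub>?S\<^esub> v \<otimes>\<^bsub>?S\<^esub> w = u \<otimes>\<^bsub>?S\<^esub> (v \<otimes>\<^bsub>?S\<^esub> w)"
    if "u \<in> carrier ?S" "v \<in> carrier ?S" "w \<in> carrier ?S" for u v w
    using that p
    by (auto simp: semidirect_G_carrier semidirect_G_mult even_mod_two_power mod_simps algebra_simps)
  show "\<exists>v\<in>carrier ?S. v \<otimes>\<^bsub>?S\<^esub> u = \<one>\<^bsub>?S\<^esub>" if "u \<in> carrier ?S" for u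
  proof -
    obtain x j where u: "u = (x, j)" by force
    let ?v = "((if even j then - x else x) mod int p, (- j) mod 2 ^ m)"
    have "?v \<otimes>\<^bsub>?S\<^esub> u = \<one>\<^bsub>?S\<^esub>"
      using that p
      by (auto simp: u semidirect_G_carrier semidirect_G_mult semidirect_G_one even_mod_two_power mod_simps)
    moreover have "?v \<in> carrier ?S" using p by (simp add: semidirect_G_carrier)
    ultimately show ?thesis by blast
  qed
qed (use p in \<open>auto simp: semidirect_G_carrier semidirect_G_mult semidirect_G_one\<close>)

lemma semidirect_G_pow_left:
  assumes "p > 1"
  shows "(1, 0) [^]\<^bsub>semidirect_G p m\<^esub> (i :: nat) = (int i mod int p, 0)"
  by (induction i) (use assms in \<open>auto simp: semidirect_G_one semidirect_G_mult mod_simps algebra_simps\<close>)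

lemma semidirect_G_pow_right:
  "(0, 1) [^]\<^bsub>semidirect_G p m\<^esub> (j :: nat) = (0, int j mod 2 ^ m)"
  by (induction j) (use p in \<open>auto simp: semidirect_G_one semidirect_G_mult mod_simps algebra_simps\<close>)


lemma presented_G_iso_semidirect_G:
  assumes "p > 1"
  shows "presented_G p m \<cong> semidirect_G p m"
proof (rule presented_G_iso[OF group_semidirect_G, where a = "(1, 0)" and b = "(0, 1)"])
  let ?S = "semidirect_G p m"
  interpret S: group ?S by (rule group_semidirect_G)
  have two: "(1 :: int) < 2 ^ m" using m by (simp add: one_less_power)
  show carr: "(1, 0) \<in> carrier ?S" "(0, 1) \<in> carrier ?S"
    using assms two by (auto simp: semidirect_G_carrier)
  show "(1, 0) [^]\<^bsub>?S\<^esub> p = \<one>\<^bsub>?S\<^esub>"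
    using assms by (simp add: semidirect_G_pow_left semidirect_G_one)
  show "(0, 1) [^]\<^bsub>?S\<^esub> ((2::nat) ^ m) = \<one>\<^bsub>?S\<^esub>"
    by (simp add: semidirect_G_pow_right semidirect_G_one)
  have "inv\<^bsub>?S\<^esub> (0, 1) = (0, (- 1) mod 2 ^ m)"
    using p carr by (intro S.inv_equality)
      (auto simp: semidirect_G_carrier semidirect_G_mult semidirect_G_one mod_simps)
  then show "(0, 1) \<otimes>\<^bsub>?S\<^esub> (1, 0) \<otimes>\<^bsub>?S\<^esub> inv\<^bsub>?S\<^esub> (0, 1) \<otimes>\<^bsub>?S\<^esub> (1, 0) = \<one>\<^bsub>?S\<^esub>"
    using assms two by (simp add: semidirect_G_mult semidirect_G_one even_mod_two_power mod_simps)
next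
  let ?S = "semidirect_G p m"
  have nf: "(1, 0) [^]\<^bsub>?S\<^esub> i \<otimes>\<^bsub>?S\<^esub> (0, 1) [^]\<^bsub>?S\<^esub> j = (int i mod int p, int j mod 2 ^ m)"
    for i j :: nat
    using assms by (simp add: semidirect_G_pow_left semidirect_G_pow_right semidirect_G_mult)
  show "\<exists>(i::nat) (j::nat). u = (1, 0) [^]\<^bsub>?S\<^esub> i \<otimes>\<^bsub>?S\<^esub> (0, 1) [^]\<^bsub>?S\<^esub> j"
    if U: "u \<in> carrier ?S" for u
  proof -
    obtain x y where u: "u = (x, y)" "0 \<le> x" "x < int p" "0 \<le> y" "y < 2 ^ m"
      using U by (auto simp: semidirect_G_carrier)
    then have "u = (1, 0) [^]\<^bsub>?S\<^esub> nat x \<otimes>\<^bsub>?S\<^esub> (0, 1) [^]\<^bsub>?S\<^esub> nat y"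
      unfolding nf by simp
    then show ?thesis by blast
  qed
  show "i = 0 \<and> j = 0"
    if "i < p" "j < 2 ^ m" "(1, 0) [^]\<^bsub>?S\<^esub> i \<otimes>\<^bsub>?S\<^esub> (0, 1) [^]\<^bsub>?S\<^esub> j = \<one>\<^bsub>?S\<^esub>" for i j :: nat
  proof -
    have "int j < 2 ^ m" using that(2) by (metis of_nat_less_iff of_nat_numeral of_nat_power)
    then show ?thesis using that unfolding nf by (simp add: semidirect_G_one)
  qed
qed (use p in simp)

end

section \<open>Groups whose proper subgroups are cyclic\<close>

locale minimal_noncyclic_group = group G for G (structure) +
  assumes finite_carrier: "finite (carrier G)"
    and noncommutative: "\<exists>x\<in>carrier G. \<exists>y\<in>carrier G. x \<otimes> y \<noteq> y \<otimes> x"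
    and proper_subgroup_cyclic:
      "\<And>H. subgroup H G \<Longrightarrow> H \<noteq> carrier G \<Longrightarrow> \<exists>c\<in>H. \<forall>x\<in>H. \<exists>i::nat. x = c [^] i"
begin

lemma proper_subgroup_commute:
  assumes "subgroup H G" "H \<noteq> carrier G" "x \<in> H" "y \<in> H"
  shows "x \<otimes> y = y \<otimes> x"
proof -
  obtain c where c: "c \<in> H" "\<forall>x\<in>H. \<exists>i::nat. x = c [^] i"
    using proper_subgroup_cyclic assms by blast
  then obtain i k :: nat where "x = c [^] i" "y = c [^] k" using assms by blast
  moreover have "c \<in> carrier G" using c assms subgroup.subset by blast
  ultimately show ?thesis by (simp add: nat_pow_comm)
qed

lemma subgroup_noncommuting_eq_carrier:
  assumes "subgroup H G" "x \<in> H" "y \<in> H" "x \<otimes> y \<noteq> y \<otimes> x"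
  shows "H = carrier G"
  using proper_subgroup_commute assms by blast

lemma centralizer_commute:
  assumes g: "g \<in> carrier G" "g \<notin> center" and "x \<in> centralizer g" "y \<in> centralizer g"
  shows "x \<otimes> y = y \<otimes> x"
proof (rule proper_subgroup_commute[OF subgroup_centralizer[OF finite_carrier g(1)] _ assms(3,4)])
  show "centralizer g \<noteq> carrier G"
  proof
    assume eq: "centralizer g = carrier G"
    have "g \<otimes> y = y \<otimes> g" if "y \<in> carrier G" for y
      using that unfolding eq[symmetric] by (simp add: centralizer_def)
    then show False using g by (simp add: center_def)
  qed
qed

text \<open>Commuting is an equivalence relation on the noncentral elements, with the noncentral parts of the
  centralizers as classes, since centralizers of noncentral elements are proper and thus abelian.\<close>

lemma centralizer_eq:
  assumes g: "g \<in> carrier G" "g \<notin> center" and x: "x \<in> centralizer g" "x \<notin> center"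
  shows "centralizer x = centralizer g"
proof
  have xG: "x \<in> carrier G" using x by (simp add: centralizer_def)
  show "centralizer g \<subseteq> centralizer x"
    using centralizer_commute[OF g _ x(1)] by (auto simp: centralizer_def)
  have "g \<in> centralizer x" using x g by (simp add: centralizer_def)
  then show "centralizer x \<subseteq> centralizer g"
    using centralizer_commute[OF xG x(2)] g by (auto simp: centralizer_def)
qed

lemma conj_by_center_iff:
  assumes "h \<in> carrier G" "x \<in> carrier G"
  shows "conj_by h x \<in> center \<longleftrightarrow> x \<in> center"
proof -
  have *: "conj_by k y \<in> center" if "y \<in> center" "k \<in> carrier G" for k y
  proof -
    have "conj_by k y = y" using that by (subst conj_by_eq_iff) (auto simp: center_def)
    then show ?thesis using that by simp
  qed
  show ?thesis using *[of x h] *[of "conj_by h x" "inv h"] assms by auto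
qed

lemma conj_by_centralizer:
  assumes "h \<in> carrier G" "g \<in> carrier G" "x \<in> centralizer g"
  shows "conj_by h x \<in> centralizer (conj_by h g)"
  using assms by (simp add: centralizer_def flip: conj_by_mult)

text \<open>If \<open>h\<close> maps one noncentral element of the centralizer \<open>C\<close> of \<open>g\<close> into \<open>C\<close>, then it normalizes
  \<open>C\<close>, since both elements have centralizer \<open>C\<close>. The normalizer of \<open>C\<close> is proper when \<open>C\<close> is not
  normal, hence abelian, and it contains \<open>g\<close>.\<close>

lemma self_normalizing:
  assumes g: "g \<in> carrier G" "g \<notin> center"
    and nonnormal: "k \<in> carrier G" "u \<in> centralizer g" "conj_by k u \<notin> centralizer g"
    and h: "h \<in> carrier G" and x: "x \<in> centralizer g" "x \<notin> center"
    and hx: "conj_by h x \<in> centralizer g"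
  shows "h \<in> centralizer g"
proof -
  \<comment> \<open>The normalizer; on a finite group the inclusion \<open>h C h\<^sup>-\<^sup>1 \<subseteq> C\<close> suffices.\<close>
  define N where "N = {h \<in> carrier G. \<forall>u\<in>centralizer g. conj_by h u \<in> centralizer g}"
  have CG: "u \<in> carrier G" if "u \<in> centralizer g" for u using that by (simp add: centralizer_def)
  have N: "subgroup N G"
  proof (rule finite_subgroupI[OF finite_carrier])
    fix a b assume "a \<in> N" "b \<in> N"
    then show "a \<otimes> b \<in> N" using CG by (auto simp: N_def simp flip: conj_by_conj_by)
  qed (use CG in \<open>auto simp: N_def\<close>)
  have "N \<noteq> carrier G" using nonnormal by (auto simp: N_def)
  have "conj_by h v \<in> centralizer g" if v: "v \<in> centralizer g" for v
  proof -
    have "conj_by h v \<in> centralizer (conj_by h x)"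
      using conj_by_centralizer[OF h, of x v] v x CG centralizer_eq[OF g x] by simp
    also have "\<dots> = centralizer g"
      using centralizer_eq[OF g hx] conj_by_center_iff[OF h] x CG by simp
    finally show ?thesis .
  qed
  then have hN: "h \<in> N" using h by (simp add: N_def)
  have gN: "g \<in> N"
  proof -
    have "conj_by g u \<in> centralizer g" if "u \<in> centralizer g" for u
    proof -
      have "conj_by g u = u" using that g by (subst conj_by_eq_iff) (auto simp: centralizer_def)
      then show ?thesis using that by simp
    qed
    then show ?thesis using g by (simp add: N_def)
  qed
  have "h \<otimes> g = g \<otimes> h"
    by (rule proper_subgroup_commute[OF N \<open>N \<noteq> carrier G\<close> hN gN])
  then show ?thesis using h by (simp add: centralizer_def)
qed

definition conjugate_union :: "'a \<Rightarrow> 'a set" where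
  "conjugate_union g = (\<lambda>(h, x). conj_by h x) ` (carrier G \<times> (centralizer g - center))"

lemma mem_conjugate_union_iff:
  "v \<in> conjugate_union g \<longleftrightarrow>
    (\<exists>h\<in>carrier G. \<exists>x\<in>centralizer g. x \<notin> center \<and> v = conj_by h x)"
  by (auto simp: conjugate_union_def)

text \<open>By \<open>self_normalizing\<close>, two pairs \<open>(h, x)\<close> and \<open>(h', x')\<close> give the same conjugate only if
  \<open>x = x'\<close> and \<open>h\<close>, \<open>h'\<close> lie in the same left coset of the centralizer.\<close>

lemma card_conjugate_union:
  assumes g: "g \<in> carrier G" "g \<notin> center"
    and nonnormal: "k \<in> carrier G" "u \<in> centralizer g" "conj_by k u \<notin> centralizer g"
  shows "card (carrier G) * card (centralizer g - center) = card (centralizer g) * card (conjugate_union g)"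
proof -
  let ?C = "centralizer g" and ?f = "\<lambda>(h, x). conj_by h x"
  let ?P = "carrier G \<times> (?C - center)"
  have CG: "?C \<subseteq> carrier G" by (auto simp: centralizer_def)
  have finP: "finite ?P" using finite_carrier CG by (auto intro: finite_subset)
  have fibre: "card {q \<in> ?P. ?f q = v} = card ?C" if v: "v \<in> ?f ` ?P" for v
  proof -
    obtain h x where hx: "h \<in> carrier G" "x \<in> ?C" "x \<notin> center" "v = conj_by h x"
      using v by auto
    have xG: "x \<in> carrier G" using hx CG by blast
    have "{q \<in> ?P. ?f q = v} = (\<lambda>t. (h \<otimes> t, x)) ` ?C"
    proof (intro subset_antisym subsetI)
      fix q assume "q \<in> {q \<in> ?P. ?f q = v}"
      then obtain h' y where q: "q = (h', y)" "h' \<in> carrier G" "y \<in> ?C" "y \<notin> center"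
        "conj_by h' y = conj_by h x" using hx by auto
      have yG: "y \<in> carrier G" using q CG by blast
      let ?t = "inv h \<otimes> h'"
      have ty: "conj_by ?t y = x"
        using q hx xG yG by (simp flip: conj_by_conj_by)
      then have t: "?t \<in> ?C"
        using self_normalizing[OF g nonnormal _ q(3,4), of ?t] q hx by simp
      then have "conj_by ?t y = y"
        using centralizer_commute[OF g t q(3)] CG yG by (subst conj_by_eq_iff) auto
      then have "y = x" using ty by simp
      moreover have "h' = h \<otimes> ?t" using q hx by (simp flip: m_assoc)
      ultimately show "q \<in> (\<lambda>t. (h \<otimes> t, x)) ` ?C" using t q by blast
    next
      fix q assume "q \<in> (\<lambda>t. (h \<otimes> t, x)) ` ?C"
      then obtain t where t: "t \<in> ?C" "q = (h \<otimes> t, x)" by blast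
      have tG: "t \<in> carrier G" using t CG by blast
      have "conj_by t x = x"
        using centralizer_commute[OF g t(1) hx(2)] tG xG by (subst conj_by_eq_iff) auto
      then have "conj_by (h \<otimes> t) x = v" using tG xG hx by (simp flip: conj_by_conj_by)
      then show "q \<in> {q \<in> ?P. ?f q = v}" using t tG hx by simp
    qed
    moreover have "inj_on (\<lambda>t. (h \<otimes> t, x)) ?C"
      using hx CG by (auto simp: inj_on_def subset_iff)
    ultimately show ?thesis by (simp add: card_image)
  qed
  have "card (carrier G) * card (?C - center) = card ?P"
    by (simp add: card_cartesian_product)
  also have "\<dots> = (\<Sum>v\<in>?f ` ?P. card {q \<in> ?P. ?f q = v})"
    using sum.image_gen[OF finP, of "\<lambda>_. 1::nat" ?f] by simp
  also have "\<dots> = (\<Sum>v\<in>?f ` ?P. card ?C)"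
    by (rule sum.cong[OF refl fibre])
  finally show ?thesis by (simp add: conjugate_union_def)
qed

lemma conjugate_union_noncentral: "conjugate_union g \<subseteq> carrier G - center"
  by (auto simp: conjugate_union_def conj_by_center_iff centralizer_def)

text \<open>The center has index at least 2 in the centralizer of a noncentral element, so at least half of
  that centralizer is noncentral.\<close>

lemma half_le_card_conjugate_union:
  assumes g: "g \<in> carrier G" "g \<notin> center"
    and nonnormal: "k \<in> carrier G" "u \<in> centralizer g" "conj_by k u \<notin> centralizer g"
  shows "card (carrier G) \<le> 2 * card (conjugate_union g)"
proof -
  let ?C = "centralizer g"
  have CG: "?C \<subseteq> carrier G" by (auto simp: centralizer_def)
  have ZC: "center \<subseteq> ?C" using g by (auto simp: center_def centralizer_def)
  have finC: "finite ?C" using finite_carrier CG by (rule finite_subset[rotated])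
  have "card center \<le> card (?C - center)"
  proof (rule card_inj_on_le)
    show "inj_on ((\<otimes>) g) center" using g by (auto simp: inj_on_def center_def)
    show "(\<otimes>) g ` center \<subseteq> ?C - center"
    proof
      fix y assume "y \<in> (\<otimes>) g ` center"
      then obtain z where z: "z \<in> center" "y = g \<otimes> z" by blast
      have zG: "z \<in> carrier G" using z by (simp add: center_def)
      have "y \<in> ?C" using z zG g unfolding centralizer_def center_def mem_Collect_eq
        by (metis m_assoc m_closed)
      moreover have "y \<notin> center"
      proof
        assume "y \<in> center"
        then have "y \<otimes> inv z \<in> center"
          using z subgroup_center[OF finite_carrier] by (meson subgroup.m_closed subgroup.m_inv_closed)
        then show False using z zG g by (simp add: m_assoc)
      qed
      ultimately show "y \<in> ?C - center" by simp
    qed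
  qed (use finC in simp)
  moreover have "card ?C = card center + card (?C - center)"
    using ZC finC by (metis card_Diff_subset card_mono finite_subset le_add_diff_inverse)
  ultimately have "card ?C \<le> 2 * card (?C - center)" by simp
  then have "card (carrier G) * card ?C \<le> card (carrier G) * (2 * card (?C - center))"
    by (rule mult_le_mono2)
  also have "\<dots> = 2 * (card (carrier G) * card (?C - center))" by simp
  also have "\<dots> = card ?C * (2 * card (conjugate_union g))"
    unfolding card_conjugate_union[OF assms] by simp
  finally have "card (carrier G) * card ?C \<le> card ?C * (2 * card (conjugate_union g))" .
  moreover have "card ?C > 0" using finC g by (auto simp: card_gt_0_iff centralizer_def)
  ultimately show ?thesis by (simp add: mult.commute)
qed

text \<open>With \<open>n\<close>, \<open>c\<close>, \<open>z\<close> for the orders of the group, the centralizer and the center, equality would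
  turn the count \<open>n (c - z) = c u\<close>, where \<open>u\<close> is the size of the union, into \<open>n z = c z\<close>.\<close>

lemma conjugate_union_not_all:
  assumes g: "g \<in> carrier G" "g \<notin> center"
    and nonnormal: "k \<in> carrier G" "u \<in> centralizer g" "conj_by k u \<notin> centralizer g"
  shows "conjugate_union g \<noteq> carrier G - center"
proof
  assume eq: "conjugate_union g = carrier G - center"
  let ?C = "centralizer g"
  let ?n = "card (carrier G)" and ?c = "card ?C" and ?z = "card center"
  have CG: "?C \<subseteq> carrier G" by (auto simp: centralizer_def)
  have ZC: "center \<subseteq> ?C" using g by (auto simp: center_def centralizer_def)
  have finC: "finite ?C" using finite_carrier CG by (rule finite_subset[rotated])
  have finZ: "finite center" using finC ZC by (rule finite_subset[rotated])
  have "conj_by k u \<in> carrier G" using nonnormal(1,2) CG by (intro conj_by_closed) blast+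
  then have "?C \<subset> carrier G" using nonnormal(3) CG by blast
  then have "?c < ?n" by (rule psubset_card_mono[OF finite_carrier])
  moreover have "?z > 0" using finZ subgroup.one_closed[OF subgroup_center[OF finite_carrier]]
    by (auto simp: card_gt_0_iff)
  moreover have prod: "?n * (?c - ?z) = ?c * (?n - ?z)"
  proof -
    have "card (?C - center) = ?c - ?z" "card (carrier G - center) = ?n - ?z"
      using ZC CG finZ by (simp_all only: card_Diff_subset subset_trans)
    then show ?thesis using card_conjugate_union[OF assms] unfolding eq by simp
  qed
  moreover have "?z \<le> ?c" "?z \<le> ?n" using ZC CG finC finite_carrier by (auto intro!: card_mono)
  then obtain c' n' where "?c = ?z + c'" "?n = ?z + n'" using le_Suc_ex by blast
  ultimately show False by (simp add: algebra_simps)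
qed

lemma conjugate_union_disjoint:
  assumes g: "g \<in> carrier G" "g \<notin> center" and g': "g' \<in> carrier G" "g' \<notin> center"
    and "g' \<notin> conjugate_union g"
  shows "conjugate_union g \<inter> conjugate_union g' = {}"
proof (rule ccontr)
  assume "\<not> ?thesis"
  then obtain v where v: "v \<in> conjugate_union g" "v \<in> conjugate_union g'" by blast
  obtain h x where hx: "h \<in> carrier G" "x \<in> centralizer g" "x \<notin> center" and vx: "v = conj_by h x"
    using v(1) unfolding mem_conjugate_union_iff by blast
  obtain k y where ky: "k \<in> carrier G" "y \<in> centralizer g'" "y \<notin> center" and vy: "v = conj_by k y"
    using v(2) unfolding mem_conjugate_union_iff by blast
  have eq: "conj_by h x = conj_by k y" using vx vy by simp
  have G: "x \<in> carrier G" "y \<in> carrier G" using hx ky by (auto simp: centralizer_def)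
  let ?s = "inv h \<otimes> k"
  have s: "?s \<in> carrier G" and sy: "conj_by ?s y = x"
    using hx ky G by (simp_all add: conj_by_conj_by[symmetric] eq[symmetric])
  have "g' \<in> centralizer y" using ky g' by (simp add: centralizer_def)
  then have "conj_by ?s g' \<in> centralizer x" using conj_by_centralizer[OF s G(2)] sy by simp
  then have "conj_by ?s g' \<in> centralizer g" using centralizer_eq[OF g hx(2,3)] by simp
  moreover have "conj_by ?s g' \<notin> center" using conj_by_center_iff[OF s g'(1)] g' by simp
  moreover have "g' = conj_by (inv ?s) (conj_by ?s g')" using s g' by simp
  ultimately have "g' \<in> conjugate_union g"
    using s unfolding mem_conjugate_union_iff by (meson inv_closed)
  then show False using assms by blast
qed

text \<open>Otherwise there are two disjoint unions of conjugates, each containing at least half of all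
  elements, and neither contains the identity.\<close>

lemma normal_centralizer_exists:
  "\<exists>g\<in>carrier G. g \<notin> center \<and> (\<forall>h\<in>carrier G. \<forall>u\<in>centralizer g. conj_by h u \<in> centralizer g)"
proof (rule ccontr)
  assume "\<not> ?thesis"
  then have nonnormal: "\<exists>k u. k \<in> carrier G \<and> u \<in> centralizer g \<and> conj_by k u \<notin> centralizer g"
    if "g \<in> carrier G" "g \<notin> center" for g using that by blast
  obtain g where g: "g \<in> carrier G" "g \<notin> center"
    using noncommutative unfolding center_def by blast
  obtain g' where g': "g' \<in> carrier G" "g' \<notin> center" "g' \<notin> conjugate_union g"
    using nonnormal[OF g] conjugate_union_not_all[OF g] conjugate_union_noncentral[of g] by blast
  have half: "card (carrier G) \<le> 2 * card (conjugate_union x)" if "x \<in> carrier G" "x \<notin> center" for x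
    using half_le_card_conjugate_union[OF that] nonnormal[OF that] by blast
  have fin: "finite (conjugate_union x)" for x
    using finite_carrier conjugate_union_noncentral[of x] by (auto intro: finite_subset)
  have "card (carrier G) \<le> card (conjugate_union g) + card (conjugate_union g')"
    using half[OF g] half[OF g'(1,2)] by simp
  also have "\<dots> = card (conjugate_union g \<union> conjugate_union g')"
    using conjugate_union_disjoint[OF g g'] fin by (simp add: card_Un_disjoint)
  also have "\<dots> \<le> card (carrier G - {\<one>})"
    using finite_carrier conjugate_union_noncentral[of g] conjugate_union_noncentral[of g']
      subgroup.one_closed[OF subgroup_center[OF finite_carrier]]
    by (intro card_mono) auto
  also have "\<dots> < card (carrier G)" using finite_carrier by (intro psubset_card_mono) auto
  finally show False by simp
qed

end

section \<open>Recognizing the quaternion group\<close>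

text \<open>The exponents \<open>(i, e)\<close> for which a quaternion unit is the product of the \<open>i\<close>-th power of the unit
  \<open>i\<close> and the \<open>e\<close>-th power of the unit \<open>j\<close>.\<close>

definition Q8_exponents :: "int_quat \<Rightarrow> nat \<times> nat" where
  "Q8_exponents q =
    (if q = (1, 0, 0, 0) then (0, 0) else if q = (0, 1, 0, 0) then (1, 0)
     else if q = (-1, 0, 0, 0) then (2, 0) else if q = (0, -1, 0, 0) then (3, 0)
     else if q = (0, 0, 1, 0) then (0, 1) else if q = (0, 0, 0, 1) then (1, 1)
     else if q = (0, 0, -1, 0) then (2, 1) else (3, 1))"

text \<open>The factor \<open>3\<^sup>e\<close> comes from moving \<open>j\<close> past a power of \<open>i\<close>, which inverts that power, and the
  term \<open>2 e l\<close> from \<open>j\<^sup>2 = i\<^sup>2\<close>.\<close>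

lemma Q8_exponents_mult:
  assumes "q \<in> carrier Q8" "q' \<in> carrier Q8" "Q8_exponents q = (i, e)" "Q8_exponents q' = (k, l)"
  shows "Q8_exponents (q \<otimes>\<^bsub>Q8\<^esub> q') = ((i + 3 ^ e * k + 2 * (e * l)) mod 4, (e + l) mod 2)"
  using assms unfolding Q8_def
  by (simp only: partial_object.simps monoid.simps insert_iff empty_iff, elim disjE)
    (simp_all add: Q8_exponents_def, auto)

lemma Q8_exponents_surj:
  assumes "i < 4" "e < 2"
  obtains q where "q \<in> carrier Q8" "Q8_exponents q = (i, e)"
proof -
  have "i = 0 \<or> i = 1 \<or> i = 2 \<or> i = 3" "e = 0 \<or> e = 1" using assms by auto
  then have "\<exists>q\<in>carrier Q8. Q8_exponents q = (i, e)"
    by (auto simp: Q8_def Q8_exponents_def)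
  then show ?thesis using that by blast
qed

lemma Q8_exponents_eq_zero:
  "q \<in> carrier Q8 \<Longrightarrow> Q8_exponents q = (0, 0) \<Longrightarrow> q = \<one>\<^bsub>Q8\<^esub>"
  by (auto simp: Q8_def Q8_exponents_def split: if_splits)

lemma Q8_exponents_bounds:
  "q \<in> carrier Q8 \<Longrightarrow> Q8_exponents q = (i, e) \<Longrightarrow> i < 4 \<and> e < 2"
  by (auto simp: Q8_exponents_def split: if_splits)

text \<open>The relations determine the product of two normal forms \<open>a\<^sup>i w\<^sup>e\<close> by the same formula as for the
  exponents of quaternion units, so the map from \<open>Q8\<close> is a homomorphism. It is injective as \<open>w\<close> is
  not a power of \<open>a\<close>.\<close>

lemma (in group) iso_Q8I:
  assumes a: "a \<in> carrier G" and w: "w \<in> carrier G" and ord: "ord a = 4"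
    and ww: "w \<otimes> w = a [^] (2::nat)" and wa: "w \<otimes> a = a [^] (3::nat) \<otimes> w"
    and w_notin: "\<And>i::nat. w \<noteq> a [^] i"
    and gen: "\<And>x. x \<in> carrier G \<Longrightarrow> \<exists>(i::nat) (e::nat). e < 2 \<and> x = a [^] i \<otimes> w [^] e"
  shows "G \<cong> Q8"
proof -
  define N where "N i e = a [^] (i::nat) \<otimes> w [^] (e::nat)" for i e
  have red: "a [^] (i mod 4) = a [^] i" for i :: nat using pow_mod_ord[OF a] ord by simp
  have swap: "w \<otimes> a [^] k = a [^] (3 * k) \<otimes> w" for k :: nat
  proof (induction k)
    case (Suc k)
    have "w \<otimes> a [^] Suc k = (w \<otimes> a [^] k) \<otimes> a" using a w by (simp add: m_assoc)
    also have "\<dots> = a [^] (3 * k) \<otimes> (w \<otimes> a)" using a w by (simp add: Suc m_assoc)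
    also have "\<dots> = (a [^] (3 * k) \<otimes> a [^] (3::nat)) \<otimes> w"
      unfolding wa using a w by (simp only: m_assoc nat_pow_closed)
    also have "\<dots> = a [^] (3 * Suc k) \<otimes> w" using a by (simp only: nat_pow_mult) (simp add: algebra_simps)
    finally show ?case .
  qed (use w in simp)
  have N_mult: "N i e \<otimes> N k l = N ((i + 3 ^ e * k + 2 * (e * l)) mod 4) ((e + l) mod 2)"
    if "e < 2" "l < 2" for i e k l
  proof -
    have e: "e = 0 \<or> e = 1" and l: "l = 0 \<or> l = 1" using that by auto
    have w1: "N i e \<otimes> N k l = a [^] (i + 3 ^ e * k) \<otimes> (w [^] e \<otimes> w [^] l)"
      using e
    proof
      assume "e = 0"
      then show ?thesis using a w by (simp add: N_def nat_pow_mult flip: m_assoc)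
    next
      assume e1: "e = 1"
      have "N i e \<otimes> N k l = a [^] i \<otimes> (w \<otimes> a [^] k) \<otimes> w [^] l"
        using a w e1 by (simp add: N_def m_assoc)
      also have "\<dots> = (a [^] i \<otimes> a [^] (3 * k)) \<otimes> (w \<otimes> w [^] l)"
        unfolding swap using a w by (simp only: m_assoc nat_pow_closed m_closed)
      also have "\<dots> = a [^] (i + 3 ^ e * k) \<otimes> (w [^] e \<otimes> w [^] l)"
        using a w e1 by (simp add: nat_pow_mult)
      finally show ?thesis .
    qed
    have w2: "w [^] e \<otimes> w [^] l = a [^] (2 * (e * l)) \<otimes> w [^] ((e + l) mod 2)"
      using e l a w ww by auto
    have "N i e \<otimes> N k l = (a [^] (i + 3 ^ e * k) \<otimes> a [^] (2 * (e * l))) \<otimes> w [^] ((e + l) mod 2)"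
      unfolding w1 w2 using a w by (simp only: m_assoc nat_pow_closed)
    then show ?thesis unfolding N_def red using a by (simp only: nat_pow_mult)
  qed
  define f where "f q = N (fst (Q8_exponents q)) (snd (Q8_exponents q))" for q
  have hom: "f \<in> hom Q8 G"
  proof (rule homI)
    fix q q' assume q: "q \<in> carrier Q8" and q': "q' \<in> carrier Q8"
    obtain i e k l where *: "Q8_exponents q = (i, e)" "Q8_exponents q' = (k, l)" by force
    show "f (q \<otimes>\<^bsub>Q8\<^esub> q') = f q \<otimes> f q'"
      using Q8_exponents_mult[OF q q' *] N_mult[of e l i k] Q8_exponents_bounds[OF q *(1)]
        Q8_exponents_bounds[OF q' *(2)] by (simp add: f_def *)
  qed (use a w in \<open>simp add: f_def N_def\<close>)
  interpret f: group_hom Q8 G f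
    using hom group_Q8 is_group by (simp add: group_hom_def group_hom_axioms_def)
  have "f ` carrier Q8 = carrier G"
  proof (intro subset_antisym subsetI)
    fix x assume "x \<in> carrier G"
    then obtain i e :: nat where x: "e < 2" "x = N i e" unfolding N_def using gen by blast
    have "x = N (i mod 4) e" using x by (simp add: N_def red)
    moreover obtain q where "q \<in> carrier Q8" "Q8_exponents q = (i mod 4, e)"
      by (rule Q8_exponents_surj[of "i mod 4" e]) (use x in auto)
    ultimately show "x \<in> f ` carrier Q8" by (auto simp: f_def intro!: image_eqI)
  qed auto
  moreover have "q = \<one>\<^bsub>Q8\<^esub>" if q: "q \<in> carrier Q8" and fq: "f q = \<one>" for q
  proof -
    obtain i e where ie: "Q8_exponents q = (i, e)" by force
    then have b: "i < 4" "e < 2" using Q8_exponents_bounds[OF q] by auto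
    have 1: "a [^] i \<otimes> w [^] e = \<one>" using fq by (simp add: f_def ie N_def)
    have "e = 0"
    proof (rule ccontr)
      assume "e \<noteq> 0"
      then have "e = 1" using b by simp
      then have "a [^] i \<otimes> w = \<one>" using 1 w by simp
      then have "w = inv (a [^] i)" using a w by (metis inv_equality inv_inv nat_pow_closed)
      also have "\<dots> = a [^] (4 - i)"
      proof (rule inv_equality)
        show "a [^] (4 - i) \<otimes> a [^] i = \<one>"
          using a b ord pow_ord_eq_1[OF a] by (simp add: nat_pow_mult)
      qed (use a in auto)
      finally show False using w_notin by blast
    qed
    then have "a [^] i = \<one>" using 1 a by simp
    then have "4 dvd i" using a ord by (simp add: pow_eq_id)
    then have "i = 0" using b by auto
    then show ?thesis using Q8_exponents_eq_zero[OF q] ie \<open>e = 0\<close> by simp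
  qed
  ultimately have "f \<in> iso Q8 G" unfolding f.iso_iff by blast
  then have "Q8 \<cong> G" by (rule is_isoI)
  then show ?thesis using group.iso_sym[OF group_Q8] by blast
qed

section \<open>Groups with a cyclic subgroup of index two\<close>

text \<open>The situation reached after the counting argument: \<open>M\<close> is a cyclic normal subgroup of index 2,
  and \<open>b\<close> is an element of 2-power order outside it.\<close>

locale cyclic_index_two = minimal_noncyclic_group +
  fixes M :: "'a set" and c b :: 'a and k :: nat
  assumes subgroup_M: "subgroup M G" and c_M: "c \<in> M"
    and M_powers: "\<And>x. x \<in> M \<Longrightarrow> \<exists>i::nat. x = c [^] i"
    and b_G: "b \<in> carrier G" and b_M: "b \<notin> M" and bb_M: "b \<otimes> b \<in> M"
    and conj_M: "\<And>x. x \<in> M \<Longrightarrow> conj_by b x \<in> M"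
    and conj_c: "conj_by b c \<noteq> c"
    and carrier_eq: "carrier G = M \<union> (\<otimes>) b ` M"
    and b_two_power: "b [^] ((2::nat) ^ k) = \<one>"
begin

sublocale M: subgroup M G by (rule subgroup_M)

lemma c_G: "c \<in> carrier G" using c_M by simp

lemma M_commute: "x \<in> M \<Longrightarrow> y \<in> M \<Longrightarrow> x \<otimes> y = y \<otimes> x"
  using M_powers[of x] M_powers[of y] c_G by (auto simp: nat_pow_comm)

lemma pow_M: "x \<in> M \<Longrightarrow> x [^] (i::nat) \<in> M"
  by (induction i) auto

lemma conj_by_b_involutive:
  assumes "x \<in> M" shows "conj_by b (conj_by b x) = x"
proof -
  have "conj_by b (conj_by b x) = conj_by (b \<otimes> b) x" using assms b_G by (simp add: conj_by_conj_by)
  also have "\<dots> = x"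
    using M_commute[OF bb_M assms] assms b_G by (subst conj_by_eq_iff) auto
  finally show ?thesis .
qed

text \<open>The commutator of \<open>b\<close> and \<open>c\<close>. It lies in \<open>M\<close> and is inverted by \<open>b\<close>; its order decides between
  the two families of groups.\<close>

definition d :: 'a where "d = conj_by b c \<otimes> inv c"

lemma d_M: "d \<in> M" unfolding d_def using c_M conj_M by auto

lemma d_G: "d \<in> carrier G" using d_M by simp

lemma d_ne_one: "d \<noteq> \<one>"
proof
  assume "d = \<one>"
  then have "conj_by b c = c"
    using conj_M[OF c_M] c_G b_G unfolding d_def by (metis conj_by_closed inv_closed inv_equality inv_inv)
  then show False using conj_c by simp
qed

lemma conj_c_eq: "conj_by b c = d \<otimes> c"
  using c_G b_G by (simp add: d_def m_assoc)

text \<open>As \<open>b\<^sup>2\<close> centralizes \<open>M\<close>, conjugation by \<open>b\<close> swaps \<open>c\<close> and \<open>b c b\<^sup>-\<^sup>1\<close>, and so it swaps the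
  two factors of the quotient \<open>d\<close>.\<close>

lemma conj_d: "conj_by b d = inv d"
proof -
  have "conj_by b d = c \<otimes> inv (conj_by b c)"
    unfolding d_def using c_G b_G c_M by (simp add: conj_by_mult conj_by_inv conj_by_b_involutive)
  also have "\<dots> = inv d" unfolding d_def using c_G b_G by (simp add: inv_mult_group)
  finally show ?thesis .
qed

lemma ord_pos: "x \<in> carrier G \<Longrightarrow> ord x > 0"
  using ord_ge_1[OF finite_carrier] by fastforce

lemma c_notin_coset: "v \<in> M \<Longrightarrow> c \<noteq> b \<otimes> v"
proof
  assume v: "v \<in> M" and c: "c = b \<otimes> v"
  have "b = c \<otimes> inv v" unfolding c using b_G v by (simp add: m_assoc)
  moreover have "c \<otimes> inv v \<in> M" by (rule M.m_closed[OF c_M M.m_inv_closed[OF v]])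
  ultimately show False using b_M by metis
qed

lemma b_ne_one: "b \<noteq> \<one>" using b_M M.one_closed by metis

text \<open>A power \<open>a\<close> of \<open>d\<close> of order \<open>p\<close> is inverted by \<open>b\<close>, and \<open>a \<noteq> a\<^sup>-\<^sup>1\<close> as \<open>p\<close> is odd. So \<open>a\<close> and
  \<open>b\<close> generate a nonabelian subgroup, which must be the whole group. The normal form \<open>a\<^sup>i b\<^sup>j\<close> is
  unique because the orders of \<open>a\<close> and \<open>b\<close> are coprime.\<close>

lemma presented_G_iso_if_odd_prime_dvd_ord:
  assumes p: "Factorial_Ring.prime p" "odd p" "p dvd ord d"
  obtains m where "m \<ge> 1" "presented_G p m \<cong> G"
proof -
  define a where "a = d [^] (ord d div p)"
  have a_M: "a \<in> M" using d_M by (simp add: a_def pow_M)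
  then have a_G: "a \<in> carrier G" by simp
  have ord_a: "ord a = p"
    unfolding a_def using ord_pow[OF d_G, of "ord d div p"] p ord_pos[OF d_G]
    by (auto elim!: dvdE)
  have p1: "p > 1" using p prime_gt_1_nat by blast
  have conj_a: "conj_by b a = inv a"
    using b_G d_G conj_d by (simp add: a_def conj_by_pow nat_pow_inv)
  have rel: "b \<otimes> a \<otimes> inv b \<otimes> a = \<one>"
    using conj_a a_G by (simp add: conj_by_def)
  have a_p: "a [^] p = \<one>" using pow_ord_eq_1[OF a_G] ord_a by simp
  have ab: "b \<otimes> a \<noteq> a \<otimes> b"
  proof
    assume "b \<otimes> a = a \<otimes> b"
    then have "conj_by b a = a" using a_G b_G by (subst conj_by_eq_iff) auto
    then have "a [^] (2::nat) = \<one>" using conj_a a_G by (metis numeral_2_eq_2 nat_pow_Suc nat_pow_eone r_inv One_nat_def)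
    then have "p dvd 2" using a_G ord_a by (simp add: pow_eq_id)
    then show False using p p1 dvd_imp_le[of p 2] by (cases "p = 2") auto
  qed
  define T where "T = {x. \<exists>(i::nat) (j::nat). x = a [^] i \<otimes> b [^] j}"
  have T_G: "T \<subseteq> carrier G" using a_G b_G by (auto simp: T_def)
  have "subgroup T G"
  proof (rule finite_subgroupI[OF finite_carrier T_G])
    have "\<one> = a [^] (0::nat) \<otimes> b [^] (0::nat)" by simp
    then show "\<one> \<in> T" unfolding T_def by blast
    fix x y assume "x \<in> T" "y \<in> T"
    then obtain i j i' j' :: nat where x: "x = a [^] i \<otimes> b [^] j" and y: "y = a [^] i' \<otimes> b [^] j'"
      unfolding T_def by blast
    obtain i'' j'' :: nat where *: "b [^] j \<otimes> (a [^] i' \<otimes> b [^] j') = a [^] i'' \<otimes> b [^] j''"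
      using inverted_left_mult[OF a_G b_G rel a_p, of j i' j'] p1 by auto
    have "x \<otimes> y = a [^] i \<otimes> (b [^] j \<otimes> (a [^] i' \<otimes> b [^] j'))"
      unfolding x y using a_G b_G by (simp only: m_assoc m_closed nat_pow_closed)
    also have "\<dots> = a [^] (i + i'') \<otimes> b [^] j''"
      unfolding * using a_G b_G by (simp add: nat_pow_mult flip: m_assoc)
    finally show "x \<otimes> y \<in> T" unfolding T_def by blast
  qed
  moreover have "a = a [^] (1::nat) \<otimes> b [^] (0::nat)" "b = a [^] (0::nat) \<otimes> b [^] (1::nat)"
    using a_G b_G by simp_all
  then have "a \<in> T" "b \<in> T" unfolding T_def by blast+
  ultimately have T: "T = carrier G" using subgroup_noncommuting_eq_carrier ab by blast
  have "ord b dvd 2 ^ k" using b_two_power b_G by (simp add: pow_eq_id)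
  then obtain m where m: "ord b = 2 ^ m" using divides_primepow_nat[OF two_is_prime_nat] by blast
  have "m \<noteq> 0" using m b_ne_one ord_eq_1[OF b_G] by auto
  have "presented_G p m \<cong> G"
  proof (rule presented_G_iso[OF is_group a_G b_G _ a_p _ rel])
    show "p > 0" using p1 by simp
    show "b [^] ((2::nat) ^ m) = \<one>" using m pow_ord_eq_1[OF b_G] by simp
    show "\<exists>(i::nat) (j::nat). x = a [^] i \<otimes> b [^] j" if "x \<in> carrier G" for x
      using that unfolding T[symmetric] T_def by blast
    fix i j :: nat assume ij: "i < p" "j < 2 ^ m" "a [^] i \<otimes> b [^] j = \<one>"
    have inv_ai: "a [^] i = inv (b [^] j)"
      using ij a_G b_G by (metis inv_equality nat_pow_closed)
    have "(a [^] i) [^] p = (a [^] p) [^] i" using a_G by (simp add: nat_pow_pow mult.commute)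
    then have "ord (a [^] i) dvd p" using a_p a_G by (simp flip: pow_eq_id)
    moreover have "(b [^] j) [^] ((2::nat) ^ m) = (b [^] ((2::nat) ^ m)) [^] j"
      using b_G by (simp add: nat_pow_pow mult.commute)
    then have "(b [^] j) [^] ((2::nat) ^ m) = \<one>" using pow_ord_eq_1[OF b_G] m by simp
    then have "ord (a [^] i) dvd 2 ^ m" unfolding inv_ai using b_G by (simp add: pow_eq_id)
    moreover have "coprime p (2 ^ m)" using p by simp
    ultimately have "ord (a [^] i) dvd 1" by (metis coprime_def is_unit_gcd gcd_greatest coprime_iff_gcd_eq_1)
    then have ai: "a [^] i = \<one>" using a_G ord_eq_1[of "a [^] i"] by simp
    then have "p dvd i" using a_G ord_a by (simp add: pow_eq_id)
    moreover have "b [^] j = \<one>" using ai ij b_G by simp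
    then have "2 ^ m dvd j" using b_G m by (simp add: pow_eq_id)
    ultimately show "i = 0 \<and> j = 0" using ij by (auto dest: dvd_imp_le)
  qed
  then show ?thesis using that \<open>m \<noteq> 0\<close> by (metis One_nat_def Suc_leI neq0_conv)
qed

lemma d_central_if_involution:
  assumes "d \<otimes> d = \<one>" "y \<in> carrier G"
  shows "y \<otimes> d = d \<otimes> y"
proof -
  have "inv d = d" using assms d_G by (simp add: inv_equality)
  then have b: "b \<otimes> d = d \<otimes> b" using conj_d conj_by_eq_iff[OF b_G d_G d_G] by simp
  consider "y \<in> M" | s where "s \<in> M" "y = b \<otimes> s" using assms(2) carrier_eq by blast
  then show ?thesis
  proof cases
    case 1
    then show ?thesis using M_commute d_M by blast
  next
    case 2
    have "y \<otimes> d = b \<otimes> (s \<otimes> d)" using 2 b_G d_G by (simp add: m_assoc)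
    also have "\<dots> = (b \<otimes> d) \<otimes> s" using 2 b_G d_G M_commute[OF 2(1) d_M] by (simp add: m_assoc)
    also have "\<dots> = d \<otimes> y" unfolding b using 2 b_G d_G by (simp add: m_assoc)
    finally show ?thesis .
  qed
qed

text \<open>Since \<open>d\<close> is a central involution, an involution \<open>y\<close> outside \<open>M\<close> would give a Klein four-group.
  It meets \<open>M\<close> only in 1 and \<open>d\<close>, so it does not contain \<open>c\<close>, because \<open>d\<close> commutes with \<open>b\<close> and
  \<open>c\<close> does not. Hence it is proper and cyclic, but a cyclic group has at most one involution.\<close>

lemma no_involution_outside_M:
  assumes d: "d \<otimes> d = \<one>" and y: "y \<in> carrier G" "y \<notin> M"
  shows "y \<otimes> y \<noteq> \<one>"
proof
  assume yy: "y \<otimes> y = \<one>"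
  let ?S = "{\<one>, d}"
  have S: "subgroup ?S G"
    by (rule finite_subgroupI[OF finite_carrier]) (use d d_G in auto)
  have conj_y_d: "conj_by y d = d"
    using d_central_if_involution[OF d y(1)] y d_G by (subst conj_by_eq_iff) auto
  have H: "subgroup (?S \<union> (\<otimes>) y ` ?S) G"
    by (rule subgroup_Un_coset[OF S y(1)]) (use yy y conj_y_d in auto)
  have "y \<otimes> d \<notin> M"
  proof
    assume "y \<otimes> d \<in> M"
    then have "y \<otimes> d \<otimes> inv d \<in> M" using d_M by blast
    then show False using y d_G by (simp add: m_assoc)
  qed
  have "c \<notin> ?S \<union> (\<otimes>) y ` ?S"
  proof
    assume "c \<in> ?S \<union> (\<otimes>) y ` ?S"
    then have "c = \<one> \<or> c = d" using c_M y \<open>y \<otimes> d \<notin> M\<close> by auto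
    moreover have "conj_by b d = d" using conj_d d d_G by (simp add: inv_equality)
    ultimately show False using conj_c b_G by auto
  qed
  then have "?S \<union> (\<otimes>) y ` ?S \<noteq> carrier G" using c_G by metis
  from proper_subgroup_cyclic[OF H this]
  obtain t where t: "t \<in> ?S \<union> (\<otimes>) y ` ?S" "\<forall>x\<in>?S \<union> (\<otimes>) y ` ?S. \<exists>i::nat. x = t [^] i" by blast
  have tG: "t \<in> carrier G" using t(1) subgroup.subset[OF H] by blast
  have "y \<otimes> \<one> = y" using y by simp
  then have "y \<in> ?S \<union> (\<otimes>) y ` ?S" by (metis UnCI imageI insertI1)
  then obtain i :: nat where "y = t [^] i" using t by blast
  moreover obtain j :: nat where "d = t [^] j" using t by blast
  moreover have "y \<noteq> \<one>" using y M.one_closed by metis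
  ultimately have "y = d" using cyclic_unique_involution[OF tG] yy d d_ne_one by blast
  then show False using y d_M by simp
qed

text \<open>Write the order of \<open>c\<close> as \<open>2\<^sup>n r\<close> with \<open>r\<close> odd. The element \<open>c\<^sup>r\<close> still does not commute with
  \<open>b\<close>, as \<open>d\<^sup>r \<noteq> 1\<close>. Together with \<open>b\<close> it lies in the subgroup \<open>W \<union> b W\<close>, where \<open>W\<close> is the Sylow
  2-subgroup of \<open>M\<close>; so \<open>W = M\<close>.\<close>

lemma ord_c_two_power:
  assumes no_odd: "\<And>p. Factorial_Ring.prime p \<Longrightarrow> odd p \<Longrightarrow> \<not> p dvd ord d"
  obtains n where "ord c = 2 ^ n"
proof -
  obtain n r where nr: "ord c = 2 ^ n * r" "odd r"
    using nat_two_power_times_odd[OF ord_pos[OF c_G]] by blast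
  define x where "x = c [^] r"
  have x_M: "x \<in> M" using c_M by (simp add: x_def pow_M)
  have x_n: "x [^] ((2::nat) ^ n) = \<one>"
    using pow_ord_eq_1[OF c_G] c_G nr by (simp add: x_def nat_pow_pow mult.commute)
  have conj_x: "conj_by b x = d [^] r \<otimes> x"
    unfolding x_def using b_G c_G pow_mult_distrib[OF M_commute[OF d_M c_M] d_G c_G]
    by (simp add: conj_by_pow conj_c_eq)
  have dr: "d [^] r \<noteq> \<one>"
  proof
    assume "d [^] r = \<one>"
    then have "ord d dvd r" using d_G by (simp add: pow_eq_id)
    moreover have "ord d \<noteq> 1" using d_ne_one ord_eq_1[OF d_G] by simp
    then obtain p where "Factorial_Ring.prime p" "p dvd ord d" using prime_factor_nat by blast
    ultimately show False using no_odd nr by (meson dvd_trans)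
  qed
  have "b \<otimes> x \<noteq> x \<otimes> b"
  proof
    assume "b \<otimes> x = x \<otimes> b"
    then have "conj_by b x = x" using b_G x_M by (subst conj_by_eq_iff) auto
    then show False using conj_x dr x_M d_G by simp
  qed
  \<comment> \<open>\<open>W\<close> is characteristic in \<open>M\<close> and contains \<open>b\<^sup>2\<close>, so \<open>W \<union> b W\<close> is a subgroup.\<close>
  define W where "W = {y \<in> M. \<exists>l. y [^] ((2::nat) ^ l) = \<one>}"
  have W: "subgroup W G"
  proof (rule finite_subgroupI[OF finite_carrier])
    show "W \<subseteq> carrier G" unfolding W_def by auto
    show "\<one> \<in> W" unfolding W_def by simp
    fix y z assume "y \<in> W" "z \<in> W"
    then obtain l l' where yz: "y \<in> M" "z \<in> M" "y [^] ((2::nat) ^ l) = \<one>" "z [^] ((2::nat) ^ l') = \<one>"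
      unfolding W_def by blast
    have "(y \<otimes> z) [^] ((2::nat) ^ (l + l')) = y [^] ((2::nat) ^ (l + l')) \<otimes> z [^] ((2::nat) ^ (l + l'))"
      using yz M_commute by (simp add: pow_mult_distrib)
    also have "y [^] ((2::nat) ^ (l + l')) = (y [^] ((2::nat) ^ l)) [^] ((2::nat) ^ l')"
      using yz(1) by (simp add: nat_pow_pow power_add)
    also have "z [^] ((2::nat) ^ (l + l')) = (z [^] ((2::nat) ^ l')) [^] ((2::nat) ^ l)"
      using yz(2) by (simp add: nat_pow_pow power_add mult.commute)
    finally have "(y \<otimes> z) [^] ((2::nat) ^ (l + l')) = \<one>" using yz by simp
    then show "y \<otimes> z \<in> W" unfolding W_def using yz by blast
  qed
  have "subgroup (W \<union> (\<otimes>) b ` W) G"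
  proof (rule subgroup_Un_coset[OF W b_G])
    have "(b \<otimes> b) [^] ((2::nat) ^ k) = \<one>" using b_two_power b_G by (simp add: pow_mult_distrib)
    then show "b \<otimes> b \<in> W" unfolding W_def using bb_M by blast
    fix y assume "y \<in> W"
    then obtain l where y: "y \<in> M" "y [^] ((2::nat) ^ l) = \<one>" unfolding W_def by blast
    then have "conj_by b y [^] ((2::nat) ^ l) = \<one>" using b_G by (simp flip: conj_by_pow)
    then show "conj_by b y \<in> W" unfolding W_def using y conj_M by blast
  qed
  moreover have "x \<in> W" unfolding W_def using x_M x_n by blast
  moreover have "b \<in> (\<otimes>) b ` W" using b_G subgroup.one_closed[OF W] by (metis image_eqI r_one)
  ultimately have "W \<union> (\<otimes>) b ` W = carrier G"
    using subgroup_noncommuting_eq_carrier \<open>b \<otimes> x \<noteq> x \<otimes> b\<close> by blast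
  moreover have "c \<notin> (\<otimes>) b ` W" using c_notin_coset unfolding W_def by blast
  ultimately have "c \<in> W" using c_G by blast
  then obtain l where "c [^] ((2::nat) ^ l) = \<one>" unfolding W_def by blast
  then have "ord c dvd 2 ^ l" using c_G by (simp add: pow_eq_id)
  then show ?thesis using that divides_primepow_nat[OF two_is_prime_nat] by blast
qed


text \<open>Both \<open>b\<^sup>2\<close> and \<open>d\<close> are powers of \<open>c\<close>, and the proof pins down the exponents. First, \<open>b\<^sup>2\<close> is an
  even power \<open>c\<^sup>2\<^sup>j\<close>, since otherwise it would generate \<open>M\<close>; so \<open>\<langle>c\<^sup>2, b\<rangle>\<close> is proper and \<open>b\<close> commutes
  with \<open>c\<^sup>2\<close>, which means \<open>d\<^sup>2 = 1\<close>. Then \<open>w = b c\<^sup>-\<^sup>j\<close> has square \<open>d\<close>, because \<open>w\<^sup>2\<close> is a power of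
  \<open>d\<close> and \<open>w\<close> is not an involution. If \<open>|M|\<close> were divisible by 8, then \<open>w\<close> times an element of order
  4 in \<open>M\<close> would be an involution outside \<open>M\<close>.\<close>

lemma iso_Q8_if_no_odd_prime_dvd_ord:
  assumes no_odd: "\<And>p. Factorial_Ring.prime p \<Longrightarrow> odd p \<Longrightarrow> \<not> p dvd ord d"
  shows "G \<cong> Q8"
proof -
  obtain n where n: "ord c = 2 ^ n" using ord_c_two_power no_odd by blast
  have c_one: "c \<noteq> \<one>" using conj_c b_G by auto
  have n0: "n \<noteq> 0" using n c_one ord_eq_1[OF c_G] by auto
  obtain j where j: "b \<otimes> b = c [^] (j::nat)" using M_powers[OF bb_M] by blast
  have "even j"
  proof (rule ccontr)
    assume "odd j"
    then have "coprime j (ord c)" using n by simp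
    then obtain s where s: "[j * s = 1] (mod ord c)" using cong_solve_coprime_nat by auto
    have "(b \<otimes> b) [^] s = c [^] (j * s)" using c_G by (simp add: j nat_pow_pow)
    also have "\<dots> = c [^] (j * s mod ord c)" using c_G by (simp add: pow_mod_ord)
    also have "\<dots> = c [^] (1 mod ord c)" using s by (simp add: cong_def)
    also have "\<dots> = c" using c_G by (simp only: pow_mod_ord nat_pow_eone)
    finally have cs: "(b \<otimes> b) [^] s = c" .
    have "(b \<otimes> b) [^] s \<otimes> b = b \<otimes> (b \<otimes> b) [^] s"
      using b_G by (intro group_commutes_pow) (simp_all add: m_assoc)
    then have "conj_by b c = c" unfolding cs using b_G c_G by (subst conj_by_eq_iff) auto
    then show False using conj_c by simp
  qed
  then obtain j' :: nat where j': "b \<otimes> b = c [^] (2 * j')" using j by blast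
  \<comment> \<open>\<open>S\<close> is generated by \<open>c\<^sup>2\<close>, so \<open>S \<union> b S\<close> is \<open>\<langle>c\<^sup>2, b\<rangle>\<close>. It is proper since the order of
    \<open>c\<close> is even and \<open>c\<close> is no power of \<open>c\<^sup>2\<close>.\<close>
  define S where "S = range (\<lambda>i::nat. c [^] (2 * i))"
  have S_M: "S \<subseteq> M" using c_M by (auto simp: S_def pow_M)
  have S: "subgroup S G"
  proof (rule finite_subgroupI[OF finite_carrier])
    show "S \<subseteq> carrier G" using S_M by auto
    have "\<one> = c [^] (2 * 0::nat)" by simp
    then show "\<one> \<in> S" unfolding S_def by blast
    fix x y assume "x \<in> S" "y \<in> S"
    then obtain i i' :: nat where "x = c [^] (2 * i)" "y = c [^] (2 * i')" unfolding S_def by blast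
    then have "x \<otimes> y = c [^] (2 * (i + i'))" using c_G by (simp add: nat_pow_mult distrib_left)
    then show "x \<otimes> y \<in> S" unfolding S_def by blast
  qed
  have H: "subgroup (S \<union> (\<otimes>) b ` S) G"
  proof (rule subgroup_Un_coset[OF S b_G])
    show "b \<otimes> b \<in> S" using j' unfolding S_def by blast
    fix x assume "x \<in> S"
    then obtain i :: nat where x: "x = c [^] (2 * i)" unfolding S_def by blast
    obtain l :: nat where l: "conj_by b c = c [^] l" using M_powers conj_M c_M by blast
    have "conj_by b x = c [^] (2 * (l * i))"
      using c_G b_G by (simp add: x conj_by_pow l nat_pow_pow mult_ac)
    then show "conj_by b x \<in> S" unfolding S_def by blast
  qed
  have "c \<notin> S"
  proof
    assume "c \<in> S"
    then obtain i :: nat where "c = c [^] (2 * i)" unfolding S_def by blast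
    then have "c [^] (1::int) = c [^] int (2 * i)" using c_G by (simp only: int_pow_int int_pow_1)
    then have "int (ord c) dvd int (2 * i) - 1" using c_G by (simp only: int_pow_eq)
    moreover have "2 dvd int (ord c)" using n n0 by simp
    ultimately have "even (int (2 * i) - 1)" by (rule dvd_trans[rotated])
    then show False by simp
  qed
  moreover have "c \<notin> (\<otimes>) b ` S" using c_notin_coset S_M by blast
  ultimately have "S \<union> (\<otimes>) b ` S \<noteq> carrier G" using c_G by blast
  moreover have "b \<in> S \<union> (\<otimes>) b ` S" using b_G subgroup.one_closed[OF S] by (metis UnCI image_eqI r_one)
  moreover have "c \<otimes> c = c [^] (2 * 1::nat)" using c_G by (simp add: numeral_2_eq_2)
  then have "c \<otimes> c \<in> S \<union> (\<otimes>) b ` S" unfolding S_def by blast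
  ultimately have "b \<otimes> (c \<otimes> c) = (c \<otimes> c) \<otimes> b" using proper_subgroup_commute[OF H] by blast
  then have "conj_by b (c \<otimes> c) = c \<otimes> c" using b_G c_G by (subst conj_by_eq_iff) auto
  moreover have "conj_by b (c \<otimes> c) = (d \<otimes> d) \<otimes> (c \<otimes> c)"
  proof -
    have "conj_by b (c \<otimes> c) = d \<otimes> (c \<otimes> d) \<otimes> c"
      using b_G c_G d_G by (simp add: conj_by_mult conj_c_eq m_assoc)
    then show ?thesis using c_G d_G by (simp add: M_commute[OF c_M d_M] m_assoc)
  qed
  ultimately have dd: "d \<otimes> d = \<one>" using c_G d_G by (metis l_cancel_one' m_closed r_cancel_one)
  have d_pow: "d [^] (i::nat) = \<one> \<or> d [^] i = d" for i
    by (induction i) (use d_G dd in auto)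
  have d_pow_even: "d [^] (2 * i) = \<one>" for i :: nat
    using d_G dd by (simp only: pow_two_times nat_pow_one)
  have d_inv: "inv d = d" using dd d_G by (simp add: inv_equality)
  have no_inv: "y \<in> M" if "y \<in> carrier G" "y \<otimes> y = \<one>" for y
    using no_involution_outside_M[OF dd] that by blast
  define e where "e = c [^] j'"
  \<comment> \<open>\<open>w\<close> acts on \<open>M\<close> like \<open>b\<close>, and the even power \<open>b\<^sup>2\<close> of \<open>c\<close> is divided out of its square.\<close>
  define w where "w = b \<otimes> inv e"
  have e_M: "e \<in> M" unfolding e_def using c_M by (simp add: pow_M)
  then have e_G: "e \<in> carrier G" by simp
  have w_G: "w \<in> carrier G" using b_G e_G by (simp add: w_def)
  have bw: "b = w \<otimes> e" using b_G e_G by (simp add: w_def m_assoc)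
  have w_M: "w \<notin> M" using bw e_M b_M by auto
  have conj_w: "conj_by w x = conj_by b x" if "x \<in> M" for x
  proof -
    have "conj_by w x = conj_by b (conj_by (inv e) x)"
      using b_G e_G that by (simp add: w_def conj_by_conj_by)
    also have "conj_by (inv e) x = x"
      using M_commute[of "inv e" x] e_M that by (subst conj_by_eq_iff) auto
    finally show ?thesis .
  qed
  have "w \<otimes> w = d"
  proof -
    have "conj_by b e = d [^] j' \<otimes> e"
      unfolding e_def using b_G c_G pow_mult_distrib[OF M_commute[OF d_M c_M] d_G c_G]
      by (simp add: conj_by_pow conj_c_eq)
    then have "conj_by b (inv e) = inv e \<otimes> inv (d [^] j')"
      using b_G e_G d_G by (simp add: conj_by_inv inv_mult_group)
    moreover have "w \<otimes> w = conj_by b (inv e) \<otimes> (b \<otimes> b) \<otimes> inv e"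
    proof -
      have "conj_by b (inv e) \<otimes> (b \<otimes> b) = b \<otimes> inv e \<otimes> ((inv b \<otimes> b) \<otimes> b)"
        using b_G e_G by (simp only: conj_by_def m_assoc inv_closed m_closed)
      then show ?thesis using b_G e_G by (simp add: w_def m_assoc)
    qed
    moreover have "b \<otimes> b = e \<otimes> e" using j' c_G by (simp add: e_def nat_pow_mult mult_2)
    ultimately have ww: "w \<otimes> w = inv e \<otimes> inv (d [^] j') \<otimes> e"
      using e_G d_G by (simp add: m_assoc)
    have "inv e \<otimes> inv (d [^] j') = inv (d [^] j') \<otimes> inv e"
      using M_commute e_M d_M by (simp add: pow_M)
    then have "w \<otimes> w = inv (d [^] j')" unfolding ww using e_G d_G by (simp add: m_assoc)
    moreover have "w \<otimes> w \<noteq> \<one>" using no_inv w_G w_M by blast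
    ultimately show ?thesis using d_pow[of j'] d_inv by auto
  qed
  obtain i where i: "d = c [^] (i::nat)" using M_powers[OF d_M] by blast
  \<comment> \<open>\<open>u\<close> is the only involution in \<open>M\<close>, so it equals \<open>d\<close>.\<close>
  define u where "u = c [^] ((2::nat) ^ (n - 1))"
  have "u \<otimes> u = c [^] ord c"
    using c_G n n0 by (simp add: u_def nat_pow_mult flip: mult_2 power_Suc)
  then have "u \<otimes> u = \<one>" using c_G by simp
  moreover have "u \<noteq> \<one>"
  proof
    assume "u = \<one>"
    then have "(2::nat) ^ n dvd 2 ^ (n - 1)" using c_G n by (simp add: u_def pow_eq_id)
    then show False using n0 by (simp add: dvd_power_iff_le)
  qed
  ultimately have du: "d = u"
    using cyclic_unique_involution[OF c_G i u_def dd] d_ne_one by blast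
  have "n \<noteq> 1"
  proof
    assume "n = 1"
    then have "d = c" using du c_G by (simp add: u_def)
    then have "conj_by b c = \<one>" using conj_c_eq dd by simp
    then show False using c_one b_G c_G by (metis conj_by_inject conj_by_one one_closed)
  qed
  moreover have "\<not> n \<ge> 3"
  proof
    assume n3: "n \<ge> 3"
    \<comment> \<open>\<open>v\<close> has order 4. It is an even power of \<open>c\<close>, so it commutes with \<open>w\<close>, and \<open>w v\<close> is an
      involution.\<close>
    define v where "v = c [^] ((2::nat) ^ (n - 2))"
    have v_M: "v \<in> M" using c_M by (simp add: v_def pow_M)
    have v_G: "v \<in> carrier G" using v_M by simp
    have "v \<otimes> v = u"
    proof -
      have "(2::nat) ^ (n - 2) + 2 ^ (n - 2) = 2 ^ Suc (n - 2)" by simp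
      also have "Suc (n - 2) = n - 1" using n3 by simp
      finally show ?thesis using c_G by (simp only: v_def u_def nat_pow_mult)
    qed
    have "(2::nat) ^ (n - 2) = 2 * 2 ^ (n - 3)" using n3 by (simp flip: power_Suc)
    then have "d [^] ((2::nat) ^ (n - 2)) = \<one>" using d_pow_even by metis
    then have "conj_by b v = v"
      unfolding v_def using b_G c_G pow_mult_distrib[OF M_commute[OF d_M c_M] d_G c_G]
      by (simp add: conj_by_pow conj_c_eq)
    then have "conj_by w v = v" using conj_w v_M by simp
    then have "w \<otimes> v = v \<otimes> w" using conj_by_eq_iff[OF w_G v_G v_G] by simp
    then have "(w \<otimes> v) \<otimes> (w \<otimes> v) = (w \<otimes> w) \<otimes> (v \<otimes> v)"
      using w_G v_G by (metis m_assoc m_closed)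
    also have "\<dots> = \<one>" using \<open>w \<otimes> w = d\<close> \<open>v \<otimes> v = u\<close> du dd by simp
    finally have "w \<otimes> v \<in> M" using no_inv w_G v_G by simp
    then have "(w \<otimes> v) \<otimes> inv v \<in> M" using v_M by blast
    then show False using w_M w_G v_G by (simp add: m_assoc)
  qed
  ultimately have "n = 2" using n0 by simp
  then have ord4: "ord c = 4" and d2: "d = c [^] (2::nat)" using n du by (simp_all add: u_def)
  have wc: "w \<otimes> c = c [^] (3::nat) \<otimes> w"
  proof -
    have "conj_by w c = c [^] (2::nat) \<otimes> c [^] (1::nat)"
      using conj_w[OF c_M] c_G by (simp add: conj_c_eq d2)
    also have "\<dots> = c [^] (3::nat)" using c_G by (simp only: nat_pow_mult) simp
    finally show ?thesis using conj_by_eq_iff[OF w_G c_G] c_G by simp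
  qed
  show ?thesis
  proof (rule iso_Q8I[OF c_G w_G ord4 _ wc])
    show "w \<otimes> w = c [^] (2::nat)" using \<open>w \<otimes> w = d\<close> d2 by simp
    show "w \<noteq> c [^] i" for i :: nat using w_M pow_M[OF c_M] by metis
    show "\<exists>(i::nat) (e::nat). e < 2 \<and> x = c [^] i \<otimes> w [^] e" if x: "x \<in> carrier G" for x
    proof (cases "x \<in> M")
      case True
      then obtain i :: nat where "x = c [^] i" using M_powers by blast
      then have "x = c [^] i \<otimes> w [^] (0::nat)" using c_G by simp
      then show ?thesis using zero_less_numeral by blast
    next
      case False
      then obtain s where s: "s \<in> M" "x = b \<otimes> s" using x carrier_eq by blast
      have es: "e \<otimes> s \<in> M" using e_M s by simp
      have "x = w \<otimes> (e \<otimes> s)" using s w_G e_G by (simp add: bw m_assoc)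
      also have "\<dots> = conj_by w (e \<otimes> s) \<otimes> w"
        using conj_by_eq_iff[of w "e \<otimes> s" "conj_by w (e \<otimes> s)"] w_G e_G s(1) by simp
      finally have xw: "x = conj_by b (e \<otimes> s) \<otimes> w" using conj_w[OF es] by simp
      obtain i :: nat where "conj_by b (e \<otimes> s) = c [^] i" using M_powers[OF conj_M[OF es]] by blast
      then have "x = c [^] i \<otimes> w [^] (1::nat)" using xw w_G by simp
      then show ?thesis using one_less_numeral_iff semiring_norm(76) by blast
    qed
  qed
qed

end

context minimal_noncyclic_group
begin

text \<open>The subgroup \<open>M\<close> is a normal centralizer \<open>\<langle>c\<rangle>\<close> of a noncentral element \<open>g\<close>. For every \<open>h\<close>,
  the conjugate \<open>h c h\<^sup>-\<^sup>1\<close> lies in \<open>M\<close> and commutes with \<open>c\<close>, so \<open>h\<^sup>2 \<in> M\<close>.\<close>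

lemma cyclic_index_two_exists:
  assumes \<rho>: "\<rho> \<in> hom G (GL 2)" "inj_on \<rho> (carrier G)"
  shows "\<exists>M c b k. cyclic_index_two G M c b k"
proof -
  obtain g where g: "g \<in> carrier G" "g \<notin> center"
    and normal: "\<And>h u. h \<in> carrier G \<Longrightarrow> u \<in> centralizer g \<Longrightarrow> conj_by h u \<in> centralizer g"
    using normal_centralizer_exists by blast
  let ?M = "centralizer g"
  have M: "subgroup ?M G" by (rule subgroup_centralizer[OF finite_carrier g(1)])
  obtain y where y: "y \<in> carrier G" "y \<otimes> g \<noteq> g \<otimes> y"
    using g unfolding center_def mem_Collect_eq by metis
  have y_M: "y \<notin> ?M" using y by (simp add: centralizer_def)
  then have ne: "?M \<noteq> carrier G" using y by blast
  obtain c where c: "c \<in> ?M" and c_gen: "\<forall>x\<in>?M. \<exists>i::nat. x = c [^] i"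
    using proper_subgroup_cyclic[OF M ne] by (rule bexE)
  have c_G: "c \<in> carrier G" using c by (simp add: centralizer_def)
  have g_M: "g \<in> ?M" using g by (simp add: centralizer_def)
  obtain i where i: "g = c [^] (i::nat)" using bspec[OF c_gen g_M] by blast
  have commute_c: "h \<in> ?M" if "h \<in> carrier G" "h \<otimes> c = c \<otimes> h" for h
  proof -
    have "c [^] i \<otimes> h = h \<otimes> c [^] i" using that c_G by (intro group_commutes_pow) auto
    then show ?thesis using that i by (simp add: centralizer_def)
  qed
  have squares: "h \<otimes> h \<in> ?M" if h: "h \<in> carrier G" for h
  proof (rule commute_c)
    have "conj_by h c \<in> ?M" using normal[OF h c] .
    then have "c \<otimes> conj_by h c = conj_by h c \<otimes> c" using centralizer_commute[OF g c] by simp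
    then show "h \<otimes> h \<otimes> c = c \<otimes> (h \<otimes> h)"
      using faithful_dim2_square_commutes[OF \<rho> finite_carrier h c_G] by (simp add: conj_by_def)
  qed (use h in simp)
  have "ord y > 0" using ord_ge_1[OF finite_carrier y(1)] by simp
  then obtain k r where kr: "ord y = 2 ^ k * r" "odd r" using nat_two_power_times_odd by blast
  \<comment> \<open>An odd power of \<open>y\<close> is still outside \<open>M\<close>, because \<open>y\<^sup>2\<close> is in \<open>M\<close>.\<close>
  define b where "b = y [^] r"
  have b_G: "b \<in> carrier G" using y by (simp add: b_def)
  obtain s where s: "r = 2 * s + 1" using kr(2) by (auto elim: oddE)
  have b_M: "b \<notin> ?M"
  proof
    assume b: "b \<in> ?M"
    have ys: "(y \<otimes> y) [^] s \<in> ?M" using squares[OF y(1)] subgroup.one_closed[OF M] subgroup.m_closed[OF M] by (induction s) simp_all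
    have "b = y [^] (2 * s) \<otimes> y" using y by (simp add: b_def s)
    also have "y [^] (2 * s) = (y \<otimes> y) [^] s" by (rule pow_two_times[OF y(1)])
    finally have "y = inv ((y \<otimes> y) [^] s) \<otimes> b" using y by (simp flip: m_assoc)
    then have "y \<in> ?M" using ys b by (metis subgroup.m_closed[OF M] subgroup.m_inv_closed[OF M])
    then show False using y_M by simp
  qed
  have b_k: "b [^] ((2::nat) ^ k) = \<one>"
    using pow_ord_eq_1[OF y(1)] y kr by (simp add: b_def nat_pow_pow mult.commute)
  have bb: "b \<otimes> b \<in> ?M" using squares b_G by simp
  have conj_c: "conj_by b c \<noteq> c" using commute_c[OF b_G] b_M conj_by_eq_iff[OF b_G c_G c_G] by blast
  have carr: "?M \<union> (\<otimes>) b ` ?M = carrier G"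
  proof (rule subgroup_noncommuting_eq_carrier)
    show "subgroup (?M \<union> (\<otimes>) b ` ?M) G"
      by (rule subgroup_Un_coset[OF M b_G bb normal[OF b_G]])
    show "b \<in> ?M \<union> (\<otimes>) b ` ?M" using b_G subgroup.one_closed[OF M] by (metis UnCI image_eqI r_one)
    show "g \<in> ?M \<union> (\<otimes>) b ` ?M" using g_M by simp
    show "b \<otimes> g \<noteq> g \<otimes> b" using b_M b_G by (simp add: centralizer_def)
  qed
  have "cyclic_index_two G ?M c b k"
    by (intro cyclic_index_two.intro cyclic_index_two_axioms.intro minimal_noncyclic_group_axioms)
      (fact M c b_G b_M bb conj_c b_k normal[OF b_G] carr[symmetric] bspec[OF c_gen])+
  then show ?thesis by blast
qed

end

theorem proposition3p1:
  fixes G :: "('g, 'h) monoid_scheme"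
  assumes "group G" and "finite (carrier G)" and "\<not> comm_group G"
    and "minimally_faithful G 2"
  shows "G \<cong> Q8 \<or>
    (\<exists>p m. Factorial_Ring.prime p \<and> odd p \<and> m \<ge> 1 \<and>
       G \<cong> presented_G p m \<and> presented_G p m \<cong> semidirect_G p m)"
proof -
  interpret group G by fact
  interpret minimal_noncyclic_group G
  proof
    show "finite (carrier G)" by fact
    show "\<exists>x\<in>carrier G. \<exists>y\<in>carrier G. x \<otimes>\<^bsub>G\<^esub> y \<noteq> y \<otimes>\<^bsub>G\<^esub> x"
      using assms(3) group_comm_groupI by blast
    fix H assume H: "subgroup H G" "H \<noteq> carrier G"
    let ?H = "G\<lparr>carrier := H\<rparr>"
    have "rdim ?H < 2" using assms(4) H by (simp add: minimally_faithful_def)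
    moreover have "group ?H" using H(1) by (rule subgroup_imp_group)
    moreover have "finite (carrier ?H)"
      using subgroup.subset[OF H(1)] assms(2) by (simp add: finite_subset)
    ultimately show "\<exists>c\<in>H. \<forall>x\<in>H. \<exists>i::nat. x = c [^]\<^bsub>G\<^esub> i"
      using group.rdim_less_two_imp_cyclic[of ?H] by (simp add: nat_pow_consistent[symmetric])
  qed
  obtain \<rho> where "faithful_rep G 2 \<rho>"
    using faithful_rep_rdim[OF assms(2)] assms(4) by (auto simp: minimally_faithful_def)
  then obtain M c b k where "cyclic_index_two G M c b k"
    using cyclic_index_two_exists unfolding faithful_rep_def by blast
  then interpret cyclic_index_two G M c b k .
  show ?thesis
  proof (cases "\<exists>p. Factorial_Ring.prime p \<and> odd p \<and> p dvd ord d")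
    case True
    then obtain p where p: "Factorial_Ring.prime p" "odd p" "p dvd ord d" by blast
    obtain m where m: "m \<ge> 1" "presented_G p m \<cong> G" by (rule presented_G_iso_if_odd_prime_dvd_ord[OF p])
    have R: "group (presented_G p m)"
      unfolding presented_G_def Let_def
      by (rule group_presented_group)
        (use group.is_monoid[OF group_free_group] in \<open>auto intro!: monoid.m_closed monoid.nat_pow_closed group.inv_closed[OF group_free_group] simp: free_gen_def\<close>)
    have "G \<cong> presented_G p m" by (rule group.iso_sym[OF R m(2)])
    moreover have "presented_G p m \<cong> semidirect_G p m"
      using presented_G_iso_semidirect_G m(1) prime_gt_1_nat[OF p(1)] prime_gt_0_nat[OF p(1)] by blast
    ultimately show ?thesis using p m by blast
  next
    case False
    then show ?thesis using iso_Q8_if_no_odd_prime_dvd_ord by blast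
  qed
qed

end
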